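(* Let $(A,B)$ be a regular inclusion of C*-algebras with $A$ abelian, let $X$ be the spectrum of $A$ and $F\subseteq X$ the set of free points. Let $$\Gamma=\{b\in B: E_x(b^*b)=0\ \text{ for all } x\in F\}.$$ Then: (i) $\Gamma=\bigcap_{x\in F}BJ_x=\bigcap_{x\in F}J_xB$; (ii) $\Gamma$ is a closed two-sided ideal of $B$; (iii) a necessary and sufficient condition for a given $b\in B$ to lie in $\Gamma$ is that $E_{yx}(b)=0$ for all $x,y\in F$.
   Context: An inclusion $(A,B)$ is a C*-algebra $B$ with a closed $*$-subalgebra $A$ (no units assumed). A normalizer is $n\in B$ with $nAn^*\subseteq A$, $n^*An\subseteq A$. $(A,B)$ is regular if $A$ contains an approximate unit for $B$ and the normalizers have dense linear span in $B$. For $x\in X$, $\varphi_x$ is evaluation at $x$ on $A$ and $J_x=\ker\varphi_x$; $x$ is free if $\varphi_x$ has a unique extension to a state of $B$. Products and sums of subspaces denote closed linear spans. For $x,y\in X$ put $C_{yx}=\{c\in B:cJ_x\subseteq J_yB,\ J_yc\subseteq BJ_x\}$, $H_{yx}=J_yC_{yx}=C_{yx}J_x=J_yBJ_x$, $L_{yx}=J_yB+BJ_x$, and let $B(y,x)=C_{yx}/H_{yx}$ (a quotient Banach space). The inclusion $C_{yx}\subseteq B$ induces a linear map $\Psi_{yx}:B(y,x)\to B/L_{yx}$, which is an isometric bijection. The localizing projection $E_{yx}:B\to B(y,x)$ is the quotient map $B\to B/L_{yx}$ followed by $\Psi_{yx}^{-1}$ (so $E_{yx}(b)=0$ iff $b\in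 L_{yx}$). One writes $E_x=E_{xx}$. *)

theory Defs
  imports "HOL-Analysis.Analysis"
begin

section \<open>C*-algebras, not necessarily unital\<close>

class cstar_algebra = real_normed_algebra + banach +
  fixes scaleC :: "complex \<Rightarrow> 'a \<Rightarrow> 'a"
    and star :: "'a \<Rightarrow> 'a"
  assumes scaleC_add_right: "scaleC c (a + b) = scaleC c a + scaleC c b"
    and scaleC_add_left: "scaleC (c + d) a = scaleC c a + scaleC d a"
    and scaleC_scaleC: "scaleC c (scaleC d a) = scaleC (c * d) a"
    and scaleR_scaleC: "scaleR r a = scaleC (complex_of_real r) a"
    and mult_scaleC_left: "scaleC c a * b = scaleC c (a * b)"
    and mult_scaleC_right: "a * scaleC c b = scaleC c (a * b)"
    and norm_scaleC: "norm (scaleC c a) = cmod c * norm a"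
    and star_add: "star (a + b) = star a + star b"
    and star_scaleC: "star (scaleC c a) = scaleC (cnj c) (star a)"
    and star_mult: "star (a * b) = star b * star a"
    and star_star: "star (star a) = a"
    and cstar_identity: "norm (star a * a) = (norm a)\<^sup>2"

lemma scaleC_one: "scaleC 1 a = (a :: 'a::cstar_algebra)"
  using scaleR_scaleC[of 1 a] by simp

global_interpretation complex_vector:
  vector_space "scaleC :: complex \<Rightarrow> 'a \<Rightarrow> 'a::cstar_algebra"
  defines cspan = complex_vector.span and csubspace = complex_vector.subspace
  by unfold_locales (simp_all add: scaleC_add_right scaleC_add_left scaleC_scaleC scaleC_one)

definition positive_element :: "'a::cstar_algebra \<Rightarrow> bool" where
  "positive_element a \<longleftrightarrow> (\<exists>c. a = star c * c)"

definition state :: "('a::cstar_algebra \<Rightarrow> complex) \<Rightarrow> bool" where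
  "state f \<longleftrightarrow> bounded_linear f \<and> (\<forall>c b. f (scaleC c b) = c * f b) \<and>
     (\<forall>b. f (star b * b) \<in> \<real>\<^sub>\<ge>\<^sub>0) \<and> onorm f = 1"

definition closed_ideal :: "'a::cstar_algebra set \<Rightarrow> bool" where
  "closed_ideal I \<longleftrightarrow> closed I \<and> csubspace I \<and> (\<forall>a\<in>I. \<forall>b. a * b \<in> I \<and> b * a \<in> I)"

text \<open>Products and sums of subspaces are closed linear spans.\<close>

definition sprod :: "'a::cstar_algebra set \<Rightarrow> 'a set \<Rightarrow> 'a set" where
  "sprod S T = closure (cspan {s * t | s t. s \<in> S \<and> t \<in> T})"

definition ssum :: "'a::cstar_algebra set \<Rightarrow> 'a set \<Rightarrow> 'a set" where
  "ssum S T = closure (cspan {s + t | s t. s \<in> S \<and> t \<in> T})"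


section \<open>Regular inclusions\<close>

text \<open>The algebra \<open>B\<close> of an inclusion \<open>(A, B)\<close> is the whole type \<open>'a\<close>.\<close>

definition inclusion :: "'a::cstar_algebra set \<Rightarrow> bool" where
  "inclusion A \<longleftrightarrow> closed A \<and> csubspace A \<and>
     (\<forall>a\<in>A. \<forall>b\<in>A. a * b \<in> A) \<and> (\<forall>a\<in>A. star a \<in> A)"

definition normalizer :: "'a::cstar_algebra set \<Rightarrow> 'a \<Rightarrow> bool" where
  "normalizer A n \<longleftrightarrow> (\<forall>a\<in>A. n * a * star n \<in> A) \<and> (\<forall>a\<in>A. star n * a * n \<in> A)"

text \<open>A net \<open>(u\<^sub>i)\<close> of positive contractions in \<open>A\<close> is represented by its filter of tails
  on \<open>B\<close>.\<close>

definition contains_approximate_unit :: "'a::cstar_algebra set \<Rightarrow> bool" where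
  "contains_approximate_unit A \<longleftrightarrow> (\<exists>U :: 'a filter. U \<noteq> bot \<and>
     (\<forall>\<^sub>F u in U. u \<in> A \<and> positive_element u \<and> norm u \<le> 1) \<and>
     (\<forall>b. ((\<lambda>u. u * b) \<longlongrightarrow> b) U \<and> ((\<lambda>u. b * u) \<longlongrightarrow> b) U))"

definition regular_inclusion :: "'a::cstar_algebra set \<Rightarrow> bool" where
  "regular_inclusion A \<longleftrightarrow> inclusion A \<and> contains_approximate_unit A \<and>
     closure (cspan {n. normalizer A n}) = UNIV"


section \<open>The spectrum and free points\<close>

text \<open>A point \<open>x\<close> of the spectrum of the abelian algebra \<open>A\<close> is identified with the character
  \<open>\<phi>\<^sub>x\<close>, a nonzero multiplicative linear functional on \<open>A\<close>. As a function on the whole type it is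
  made unique by taking the value \<open>undefined\<close> off \<open>A\<close>. No topology on the spectrum is needed.\<close>

definition spectrum :: "'a::cstar_algebra set \<Rightarrow> ('a \<Rightarrow> complex) set" where
  "spectrum A = {x \<in> extensional A.
     (\<forall>a\<in>A. \<forall>b\<in>A. x (a + b) = x a + x b) \<and>
     (\<forall>c. \<forall>a\<in>A. x (scaleC c a) = c * x a) \<and>
     (\<forall>a\<in>A. \<forall>b\<in>A. x (a * b) = x a * x b) \<and>
     (\<exists>a\<in>A. x a \<noteq> 0)}"

definition point_ideal :: "'a::cstar_algebra set \<Rightarrow> ('a \<Rightarrow> complex) \<Rightarrow> 'a set" where
  "point_ideal A x = {a \<in> A. x a = 0}"

definition free_points :: "'a::cstar_algebra set \<Rightarrow> ('a \<Rightarrow> complex) set" where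
  "free_points A = {x \<in> spectrum A. \<exists>!f. state f \<and> (\<forall>a\<in>A. f a = x a)}"


section \<open>Localization\<close>

definition C_space :: "'a::cstar_algebra set \<Rightarrow> ('a \<Rightarrow> complex) \<Rightarrow> ('a \<Rightarrow> complex) \<Rightarrow> 'a set" where
  "C_space A y x = {c. (\<forall>j\<in>point_ideal A x. c * j \<in> sprod (point_ideal A y) UNIV) \<and>
                 (\<forall>j\<in>point_ideal A y. j * c \<in> sprod UNIV (point_ideal A x))}"

definition H_space :: "'a::cstar_algebra set \<Rightarrow> ('a \<Rightarrow> complex) \<Rightarrow> ('a \<Rightarrow> complex) \<Rightarrow> 'a set" where
  "H_space A y x = sprod (point_ideal A y) (C_space A y x)"

definition L_space :: "'a::cstar_algebra set \<Rightarrow> ('a \<Rightarrow> complex) \<Rightarrow> ('a \<Rightarrow> complex) \<Rightarrow> 'a set" where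
  "L_space A y x = ssum (sprod (point_ideal A y) UNIV) (sprod UNIV (point_ideal A x))"

text \<open>Elements of a quotient space \<open>V / W\<close> are the cosets of \<open>W\<close>, and its zero is \<open>coset W 0\<close>.\<close>

definition coset :: "'a::cstar_algebra set \<Rightarrow> 'a \<Rightarrow> 'a set" where
  "coset W v = {v + w | w. w \<in> W}"

definition quotient_space :: "'a::cstar_algebra set \<Rightarrow> 'a set \<Rightarrow> 'a set set" where
  "quotient_space V W = coset W ` V"

definition localization ::
  "'a::cstar_algebra set \<Rightarrow> ('a \<Rightarrow> complex) \<Rightarrow> ('a \<Rightarrow> complex) \<Rightarrow> 'a set set" where
  "localization A y x = quotient_space (C_space A y x) (H_space A y x)"

text \<open>The map induced by the inclusion of \<open>C\<^sub>y\<^sub>x\<close> in \<open>B\<close>: since \<open>H\<^sub>y\<^sub>x \<subseteq> L\<^sub>y\<^sub>x\<close>, it takes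
  \<open>c + H\<^sub>y\<^sub>x\<close> to \<open>(c + H\<^sub>y\<^sub>x) + L\<^sub>y\<^sub>x = c + L\<^sub>y\<^sub>x\<close>.\<close>

definition Psi ::
  "'a::cstar_algebra set \<Rightarrow> ('a \<Rightarrow> complex) \<Rightarrow> ('a \<Rightarrow> complex) \<Rightarrow> 'a set \<Rightarrow> 'a set" where
  "Psi A y x \<xi> = (\<Union>c\<in>\<xi>. coset (L_space A y x) c)"

text \<open>The quotient map \<open>B \<rightarrow> B / L\<^sub>y\<^sub>x\<close> followed by the inverse of \<open>Psi\<close>. For a regular inclusion of an
  abelian algebra, \<open>Psi\<close> is a bijection from \<open>B(y, x) = localization A y x\<close> onto \<open>B / L\<^sub>y\<^sub>x\<close>.\<close>

definition loc_proj ::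
  "'a::cstar_algebra set \<Rightarrow> ('a \<Rightarrow> complex) \<Rightarrow> ('a \<Rightarrow> complex) \<Rightarrow> 'a \<Rightarrow> 'a set" where
  "loc_proj A y x b = inv_into (localization A y x) (Psi A y x) (coset (L_space A y x) b)"

definition Gamma_set :: "'a::cstar_algebra set \<Rightarrow> 'a set" where
  "Gamma_set A = {b. \<forall>x\<in>free_points A. loc_proj A x x (star b * b) = coset (H_space A x x) 0}"

end

theory Submission
  imports Defs
begin

text \<open>
  Write \<open>J\<^sub>x\<close> for the kernel of the character \<open>x\<close> in \<open>A\<close>, and \<open>b*\<close> for the adjoint of \<open>b\<close>, so that
  \<open>b*b\<close> is \<open>star b * b\<close>. The set \<open>\<Gamma>\<close> turns out to be the
  intersection of the left ideals \<open>BJ\<^sub>x\<close> over the free points \<open>x\<close>. Three facts carry the proof.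

  The first is analytic. The algebra \<open>J\<^sub>x\<close> has a bounded approximate unit, and \<open>b\<close> lies in
  \<open>BJ\<^sub>x\<close> exactly when \<open>b - bu\<close> tends to \<open>0\<close> along it. By the C*-identity
  \<open>\<parallel>b - bu\<parallel>\<^sup>2 = \<parallel>z - zu - u*(z - zu)\<parallel>\<close> with \<open>z = b*b\<close>, and this tends to \<open>0\<close> as soon as \<open>z\<close> lies in
  \<open>L\<^sub>x\<^sub>x = J\<^sub>xB + BJ\<^sub>x\<close>. So \<open>b*b \<in> L\<^sub>x\<^sub>x\<close> if and only if \<open>b \<in> BJ\<^sub>x\<close>
  (\<open>mem_sprod_of_star_mult_mem_ssum\<close>). The approximate unit is built by a mean ergodic argument
  (\<open>mean_ergodic_quasi_power\<close>), which takes the place of continuous functional calculus.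

  The second identifies the kernel of the localizing projection: \<open>E\<^sub>y\<^sub>x(b) = 0\<close> if and only if
  \<open>b \<in> L\<^sub>y\<^sub>x\<close> (\<open>loc_proj_zero_iff\<close>). Compressing with approximate units of \<open>J\<^sub>y\<close> and \<open>J\<^sub>x\<close> on
  either side shows that the distance from \<open>c \<in> C\<^sub>y\<^sub>x\<close> to \<open>H\<^sub>y\<^sub>x\<close> is controlled by its distance to
  \<open>L\<^sub>y\<^sub>x\<close>. Hence \<open>C\<^sub>y\<^sub>x \<inter> L\<^sub>y\<^sub>x = H\<^sub>y\<^sub>x\<close>, which makes \<open>Psi\<close> injective, and \<open>C\<^sub>y\<^sub>x + L\<^sub>y\<^sub>x\<close> is closed. Every
  normalizer lies in \<open>C\<^sub>y\<^sub>x\<close> or in \<open>L\<^sub>y\<^sub>x\<close>, so by regularity that sum is all of \<open>B\<close>, which makes \<open>Psi\<close>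
  surjective. These two facts give \<open>\<Gamma> = \<Inter>BJ\<^sub>x\<close>.

  The third is the invariance of the free points under normalizers
  (\<open>free_points_normalizer_action\<close>). A normalizer \<open>n\<close> with \<open>x(n*n) \<noteq> 0\<close> moves \<open>x\<close> to the character
  \<open>y(a) = x(n*an) / x(n*n)\<close>, and \<open>f \<mapsto> f(n* \<cdot> n) / x(n*n)\<close> carries the states extending \<open>x\<close> to states
  extending \<open>y\<close>; the adjoint of \<open>n\<close> undoes this. Since \<open>J\<^sub>yn \<subseteq> BJ\<^sub>x\<close>, the intersection of the \<open>BJ\<^sub>x\<close> over
  free \<open>x\<close> is stable under right multiplication by normalizers, hence a two-sided ideal. For \<open>b\<close> in
  it, \<open>bb*\<close> is in it too, so the first fact puts \<open>b*\<close> in it; taking adjoints turns \<open>BJ\<^sub>x\<close> into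
  \<open>J\<^sub>xB\<close>. For the last criterion, if \<open>b\<close> lies in \<open>L\<^sub>y\<^sub>x\<close> for all free \<open>x\<close> and \<open>y\<close>, the same
  invariance gives \<open>nb \<in> L\<^sub>x\<^sub>x\<close> for every normalizer \<open>n\<close>, hence \<open>Bb \<subseteq> L\<^sub>x\<^sub>x\<close>; in particular
  \<open>b*b \<in> L\<^sub>x\<^sub>x\<close>.
\<close>

section \<open>Norms, adjoints and closed complex subspaces\<close>

lemma star_zero [simp]: "star 0 = (0::'a::cstar_algebra)"
  using star_add[of 0 "0::'a"] by simp

lemma star_minus: "star (- a) = - star (a::'a::cstar_algebra)"
  using star_add[of a "-a"] by (simp add: eq_neg_iff_add_eq_0 add.commute)

lemma star_diff: "star (a - b) = star a - star (b::'a::cstar_algebra)"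
  using star_add[of a "-b"] by (simp add: star_minus)

lemma norm_star [simp]: "norm (star a) = norm (a::'a::cstar_algebra)"
proof -
  have le: "norm b \<le> norm (star b)" for b :: 'a
  proof (cases "b = 0")
    case False
    have "norm b * norm b \<le> norm (star b) * norm b"
      using cstar_identity[of b] norm_mult_ineq[of "star b" b] by (simp add: power2_eq_square)
    then show ?thesis using False by simp
  qed simp
  from le[of a] le[of "star a"] show ?thesis by (simp add: star_star)
qed

lemma bounded_linear_star: "bounded_linear (star :: 'a::cstar_algebra \<Rightarrow> 'a)"
  by (rule bounded_linear_intro[where K=1])
    (simp_all add: star_add star_scaleC scaleR_scaleC)

lemmas tendsto_star = bounded_linear.tendsto[OF bounded_linear_star]

lemma bounded_linear_scaleC: "bounded_linear (scaleC c :: 'a::cstar_algebra \<Rightarrow> 'a)"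
  by (rule bounded_linear_intro[where K="cmod c"])
    (simp_all add: scaleC_add_right scaleR_scaleC scaleC_scaleC norm_scaleC mult.commute)

lemmas tendsto_scaleC = bounded_linear.tendsto[OF bounded_linear_scaleC]

lemma scaleC_diff_right: "scaleC c (a - b) = scaleC c a - scaleC c (b::'a::cstar_algebra)"
  using complex_vector.scale_right_diff_distrib .

text \<open>The substitute for testing the bound on a unit: take \<open>b = star c\<close> and use the C*-identity.\<close>

lemma norm_le_mult_bound:
  fixes c :: "'a::cstar_algebra"
  assumes "\<And>b. norm (c * b) \<le> K * norm b" and "0 \<le> K"
  shows "norm c \<le> K"
proof (cases "c = 0")
  case False
  have "norm c * norm c = norm (c * star c)"
    using cstar_identity[of "star c"] by (simp add: star_star power2_eq_square)
  also have "\<dots> \<le> K * norm c" using assms(1)[of "star c"] by simp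
  finally show ?thesis using False by simp
qed (use assms in simp)

definition closed_csubspace :: "'a::cstar_algebra set \<Rightarrow> bool" where
  "closed_csubspace M \<longleftrightarrow> closed M \<and> csubspace M"

lemma closed_csubspaceI:
  assumes "closed M" "0 \<in> M" "\<And>a b. a \<in> M \<Longrightarrow> b \<in> M \<Longrightarrow> a + b \<in> M"
    "\<And>c a. a \<in> M \<Longrightarrow> scaleC c a \<in> M"
  shows "closed_csubspace M"
  using assms by (auto simp: closed_csubspace_def complex_vector.subspace_def)

lemma csubspace_scaleR: "csubspace M \<Longrightarrow> a \<in> M \<Longrightarrow> scaleR r a \<in> M"
  by (simp add: scaleR_scaleC complex_vector.subspace_scale)

lemma csubspace_closure:
  assumes "csubspace (M::'a::cstar_algebra set)" shows "csubspace (closure M)"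
proof -
  have add: "a + b \<in> closure M" if a: "a \<in> closure M" and b: "b \<in> closure M" for a b
  proof -
    from a b obtain p q where "\<And>n. p n \<in> M" "p \<longlonglongrightarrow> a" "\<And>n. q n \<in> M" "q \<longlonglongrightarrow> b"
      unfolding closure_sequential by auto
    then show ?thesis unfolding closure_sequential
      by (intro exI[of _ "\<lambda>n. p n + q n"])
        (auto intro: tendsto_add complex_vector.subspace_add[OF assms])
  qed
  have scale: "scaleC c a \<in> closure M" if a: "a \<in> closure M" for a c
  proof -
    from a obtain p where "\<And>n. p n \<in> M" "p \<longlonglongrightarrow> a" unfolding closure_sequential by auto
    then show ?thesis unfolding closure_sequential
      by (intro exI[of _ "\<lambda>n. scaleC c (p n)"])
        (auto intro: tendsto_scaleC complex_vector.subspace_scale[OF assms])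
  qed
  have "0 \<in> closure M"
    using complex_vector.subspace_0[OF assms] closure_subset by blast
  then show ?thesis using add scale by (simp add: complex_vector.subspace_def)
qed

lemma closed_csubspace_closure_cspan: "closed_csubspace (closure (cspan S))"
  by (simp add: closed_csubspace_def csubspace_closure complex_vector.subspace_span)

lemma closure_cspan_minimal:
  assumes "closed_csubspace M" "S \<subseteq> M" shows "closure (cspan S) \<subseteq> M"
  using assms by (simp add: closed_csubspace_def closure_minimal complex_vector.span_minimal)

lemma closed_csubspace_sprod [simp]: "closed_csubspace (sprod S T)"
  by (simp add: sprod_def closed_csubspace_closure_cspan)

lemma closed_csubspace_ssum [simp]: "closed_csubspace (ssum S T)"
  by (simp add: ssum_def closed_csubspace_closure_cspan)

lemma sprod_minimal:
  assumes "closed_csubspace M" "\<And>s t. s \<in> S \<Longrightarrow> t \<in> T \<Longrightarrow> s * t \<in> M"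
  shows "sprod S T \<subseteq> M"
  unfolding sprod_def using assms by (intro closure_cspan_minimal) auto

lemma ssum_minimal:
  assumes "closed_csubspace M" "S \<subseteq> M" "T \<subseteq> M"
  shows "ssum S T \<subseteq> M"
  unfolding ssum_def using assms
  by (intro closure_cspan_minimal)
    (auto simp: closed_csubspace_def intro!: complex_vector.subspace_add)

lemma mult_mem_sprod: "s \<in> S \<Longrightarrow> t \<in> T \<Longrightarrow> s * t \<in> sprod S T"
  unfolding sprod_def
  by (rule subsetD[OF closure_subset], rule complex_vector.span_base) auto

lemma add_mem_ssum: "s \<in> S \<Longrightarrow> t \<in> T \<Longrightarrow> s + t \<in> ssum S T"
  unfolding ssum_def
  by (rule subsetD[OF closure_subset], rule complex_vector.span_base) auto

lemma closed_csubspace_vimage: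
  assumes M: "closed_csubspace M" and f: "bounded_linear f"
    and semi: "\<And>c b. f (scaleC c b) = scaleC (g c) (f b)"
  shows "closed_csubspace (f -` M)"
proof (rule closed_csubspaceI)
  interpret bounded_linear f by fact
  have sub: "csubspace M" using M by (simp add: closed_csubspace_def)
  have "continuous_on UNIV f" by (intro linear_continuous_on f)
  then show "closed (f -` M)" using M
    by (intro closed_vimage) (auto simp: closed_csubspace_def)
  show "0 \<in> f -` M" using complex_vector.subspace_0[OF sub] by (simp add: zero)
  show "a + b \<in> f -` M" if "a \<in> f -` M" "b \<in> f -` M" for a b
    using that complex_vector.subspace_add[OF sub] by (simp add: add)
  show "scaleC c a \<in> f -` M" if "a \<in> f -` M" for c a
    using that complex_vector.subspace_scale[OF sub] by (simp add: semi)
qed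

lemma closed_csubspace_vimage_left:
  "closed_csubspace M \<Longrightarrow> closed_csubspace ((\<lambda>b. a * b) -` M)"
  by (rule closed_csubspace_vimage[where g="\<lambda>c. c"])
    (auto intro: bounded_linear_mult_right simp: mult_scaleC_right)

lemma closed_csubspace_vimage_right:
  "closed_csubspace M \<Longrightarrow> closed_csubspace ((\<lambda>b. b * a) -` M)"
  by (rule closed_csubspace_vimage[where g="\<lambda>c. c"])
    (auto intro: bounded_linear_mult_left simp: mult_scaleC_left)

lemma closed_csubspace_vimage_star:
  "closed_csubspace M \<Longrightarrow> closed_csubspace (star -` M)"
  by (rule closed_csubspace_vimage[where g=cnj])
    (auto intro: bounded_linear_star simp: star_scaleC)

lemma sprod_left_module:
  assumes "\<And>j. j \<in> J \<Longrightarrow> k * j \<in> J" "b \<in> sprod J T" shows "k * b \<in> sprod J T"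
proof -
  have "sprod J T \<subseteq> (\<lambda>b. k * b) -` sprod J T"
    by (rule sprod_minimal)
      (auto intro!: closed_csubspace_vimage_left mult_mem_sprod assms(1) simp: mult.assoc[symmetric])
  then show ?thesis using assms by auto
qed

lemma sprod_right_module:
  assumes "\<And>j. j \<in> J \<Longrightarrow> j * k \<in> J" "b \<in> sprod T J" shows "b * k \<in> sprod T J"
proof -
  have "sprod T J \<subseteq> (\<lambda>b. b * k) -` sprod T J"
    by (rule sprod_minimal)
      (auto intro!: closed_csubspace_vimage_right mult_mem_sprod assms(1) simp: mult.assoc)
  then show ?thesis using assms by auto
qed

lemma sprod_UNIV_left_ideal: "b \<in> sprod UNIV J \<Longrightarrow> a * b \<in> sprod UNIV J"
  by (rule sprod_left_module) auto

lemma sprod_UNIV_right_ideal: "b \<in> sprod J UNIV \<Longrightarrow> b * a \<in> sprod J UNIV"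
  by (rule sprod_right_module) auto

lemma star_mem_sprod_left:
  assumes "\<And>j. j \<in> J \<Longrightarrow> star j \<in> J" "b \<in> sprod UNIV J" shows "star b \<in> sprod J UNIV"
proof -
  have "sprod UNIV J \<subseteq> star -` sprod J UNIV"
    by (rule sprod_minimal)
      (auto intro: closed_csubspace_vimage_star mult_mem_sprod assms(1) simp: star_mult)
  then show ?thesis using assms by auto
qed

lemma star_mem_sprod_right:
  assumes "\<And>j. j \<in> J \<Longrightarrow> star j \<in> J" "b \<in> sprod J UNIV" shows "star b \<in> sprod UNIV J"
proof -
  have "sprod J UNIV \<subseteq> star -` sprod UNIV J"
    by (rule sprod_minimal)
      (auto intro: closed_csubspace_vimage_star mult_mem_sprod assms(1) simp: star_mult)
  then show ?thesis using assms by auto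
qed

lemma ssum_eq_closure:
  assumes "closed_csubspace S" "closed_csubspace T"
  shows "ssum S T = closure {s + t | s t. s \<in> S \<and> t \<in> T}"
proof -
  have "csubspace {s + t | s t. s \<in> S \<and> t \<in> T}"
    using assms complex_vector.subspace_sums[of S T] by (simp add: closed_csubspace_def)
  then show ?thesis by (simp add: ssum_def complex_vector.span_eq_iff[THEN iffD2])
qed

lemma ssum_superset:
  assumes "closed_csubspace S" "closed_csubspace T"
  shows "S \<subseteq> ssum S T" "T \<subseteq> ssum S T"
proof -
  have "0 \<in> S" "0 \<in> T"
    using assms by (auto simp: closed_csubspace_def intro: complex_vector.subspace_0)
  then show "S \<subseteq> ssum S T" "T \<subseteq> ssum S T"
    using add_mem_ssum[of _ S 0 T] add_mem_ssum[of 0 S _ T] by auto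
qed

lemma closed_csubspace_INT:
  "(\<And>i. i \<in> I \<Longrightarrow> closed_csubspace (M i)) \<Longrightarrow> closed_csubspace (\<Inter>i\<in>I. M i)"
  by (auto simp: closed_csubspace_def complex_vector.subspace_def)

lemma closed_csubspace_Int:
  "closed_csubspace M \<Longrightarrow> closed_csubspace N \<Longrightarrow> closed_csubspace (M \<inter> N)"
  by (simp add: closed_csubspace_def complex_vector.subspace_inter closed_Int)

lemma closed_csubspaceD:
  assumes "closed_csubspace M"
  shows "closed M" "csubspace M" "0 \<in> M" "a \<in> M \<Longrightarrow> b \<in> M \<Longrightarrow> a + b \<in> M"
    "a \<in> M \<Longrightarrow> b \<in> M \<Longrightarrow> a - b \<in> M" "a \<in> M \<Longrightarrow> - a \<in> M" "a \<in> M \<Longrightarrow> scaleC c a \<in> M"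
    "(\<And>i. i \<in> I \<Longrightarrow> f i \<in> M) \<Longrightarrow> sum f I \<in> M"
  using assms unfolding closed_csubspace_def
  by (blast intro: complex_vector.subspace_0 complex_vector.subspace_add
      complex_vector.subspace_diff complex_vector.subspace_neg complex_vector.subspace_scale
      complex_vector.subspace_sum)+

text \<open>A uniformly bounded family of linear maps tends to zero pointwise on a closed subspace. It
  therefore suffices to check convergence of approximate units on generators of \<open>sprod\<close> and \<open>ssum\<close>.\<close>

lemma closed_csubspace_tendsto_zero:
  fixes F :: "'i \<Rightarrow> 'a::cstar_algebra \<Rightarrow> 'a"
  assumes add: "\<And>u a b. F u (a + b) = F u a + F u b"
    and scale: "\<And>u c a. F u (scaleC c a) = scaleC c (F u a)"
    and bound: "\<forall>\<^sub>F u in U. \<forall>b. norm (F u b) \<le> K * norm b"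
  shows "closed_csubspace {b. ((\<lambda>u. F u b) \<longlongrightarrow> 0) U}"
proof (rule closed_csubspaceI)
  let ?M = "{b. ((\<lambda>u. F u b) \<longlongrightarrow> 0) U}"
  have diff: "F u (a - b) = F u a - F u b" for u a b
    using add[of u "a - b" b] by (simp add: algebra_simps)
  show "closed ?M"
  proof (subst closed_sequential_limits, intro allI impI, elim conjE, rule CollectI, rule tendstoI)
    fix p b and e :: real
    assume p: "\<forall>n. p n \<in> ?M" and lim: "p \<longlonglongrightarrow> b" and e: "0 < e"
    let ?d = "e / (2 * (\<bar>K\<bar> + 1))"
    have d: "0 < ?d" using e by simp
    obtain n where n: "norm (b - p n) < ?d"
      using LIMSEQ_D[OF lim d] by (auto simp: norm_minus_commute)
    have "\<forall>\<^sub>F u in U. dist (F u (p n)) 0 < e / 2" using p e by (intro tendstoD) auto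
    with bound show "\<forall>\<^sub>F u in U. dist (F u b) 0 < e"
    proof eventually_elim
      case (elim u)
      have "norm (F u (b - p n)) \<le> (\<bar>K\<bar> + 1) * norm (b - p n)"
        using elim(1)[rule_format, of "b - p n"]
        by (rule order_trans) (intro mult_right_mono, auto)
      also have "\<dots> < (\<bar>K\<bar> + 1) * ?d" using n by (intro mult_strict_left_mono) auto
      also have "\<dots> = e / 2" by (simp add: field_simps)
      finally have "norm (F u b - F u (p n)) < e / 2" by (simp add: diff)
      moreover have "norm (F u (p n)) < e / 2" using elim(2) by simp
      ultimately show ?case using norm_triangle_sub[of "F u b" "F u (p n)"] by simp
    qed
  qed
  show "0 \<in> ?M" using add[of _ 0 0] by simp
  show "a + b \<in> ?M" if "a \<in> ?M" "b \<in> ?M" for a b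
    using tendsto_add[of "\<lambda>u. F u a" 0 U "\<lambda>u. F u b" 0] that by (simp add: add)
  show "scaleC c a \<in> ?M" if "a \<in> ?M" for c a
    using tendsto_scaleC[of "\<lambda>u. F u a" 0 U c] that by (simp add: scale)
qed

section \<open>Approximate units of commutative *-subalgebras\<close>

definition commutative_star_subalgebra :: "'a::cstar_algebra set \<Rightarrow> bool" where
  "commutative_star_subalgebra J \<longleftrightarrow> csubspace J \<and> (\<forall>a\<in>J. \<forall>b\<in>J. a * b \<in> J) \<and>
     (\<forall>a\<in>J. star a \<in> J) \<and> (\<forall>a\<in>J. \<forall>b\<in>J. a * b = b * a)"

lemma commutative_star_subalgebraD:
  assumes "commutative_star_subalgebra J"
  shows "csubspace J" "a \<in> J \<Longrightarrow> b \<in> J \<Longrightarrow> a * b \<in> J" "a \<in> J \<Longrightarrow> star a \<in> J"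
    "a \<in> J \<Longrightarrow> b \<in> J \<Longrightarrow> a * b = b * a"
    "0 \<in> J" "a \<in> J \<Longrightarrow> b \<in> J \<Longrightarrow> a + b \<in> J" "a \<in> J \<Longrightarrow> b \<in> J \<Longrightarrow> a - b \<in> J"
    "a \<in> J \<Longrightarrow> scaleC c a \<in> J" "a \<in> J \<Longrightarrow> scaleR r a \<in> J"
  using assms by (auto simp: commutative_star_subalgebra_def csubspace_scaleR
      intro: complex_vector.subspace_0 complex_vector.subspace_add
        complex_vector.subspace_diff complex_vector.subspace_scale)

text \<open>Without a unit in the algebra, \<open>quasi_power z k\<close> stands for \<open>(1 + z)\<^sup>k - 1\<close>.\<close>

primrec quasi_power :: "'a::cstar_algebra \<Rightarrow> nat \<Rightarrow> 'a" where
  "quasi_power z 0 = 0"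
| "quasi_power z (Suc k) = z + quasi_power z k + z * quasi_power z k"

text \<open>For skew-adjoint \<open>z\<close> the first-order terms of \<open>(1 + z)*(1 + z) = 1 + z*z\<close> cancel, so left
  multiplication by \<open>1 + z\<close> is a contraction up to a term quadratic in \<open>z\<close>.\<close>

lemma norm_one_plus_skew:
  fixes z b :: "'a::cstar_algebra"
  assumes "star z = - z"
  shows "norm (b + z * b) \<le> (1 + (norm z)\<^sup>2) * norm b"
proof -
  have eq: "star (b + z * b) * (b + z * b) = star b * b + star (z * b) * (z * b)"
    by (simp add: star_add star_mult assms algebra_simps)
  have "(norm (b + z * b))\<^sup>2 \<le> (norm b)\<^sup>2 + (norm (z * b))\<^sup>2"
    unfolding cstar_identity[symmetric] eq by (rule norm_triangle_ineq)
  also have "\<dots> \<le> (norm b)\<^sup>2 + (norm z * norm b)\<^sup>2"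
    by (intro add_left_mono power_mono norm_mult_ineq norm_ge_zero)
  also have "\<dots> = (1 + (norm z)\<^sup>2) * (norm b)\<^sup>2" by (simp add: algebra_simps power_mult_distrib)
  also have "\<dots> \<le> (1 + (norm z)\<^sup>2)\<^sup>2 * (norm b)\<^sup>2"
    by (intro mult_right_mono self_le_power) auto
  finally have "(norm (b + z * b))\<^sup>2 \<le> ((1 + (norm z)\<^sup>2) * norm b)\<^sup>2"
    by (simp add: power_mult_distrib)
  then show ?thesis by (rule power2_le_imp_le) simp
qed

lemma norm_quasi_power:
  fixes z b :: "'a::cstar_algebra"
  assumes "star z = - z"
  shows "norm (b + quasi_power z k * b) \<le> (1 + (norm z)\<^sup>2) ^ k * norm b"
proof (induction k)
  case (Suc k)
  let ?y = "b + quasi_power z k * b"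
  have "b + quasi_power z (Suc k) * b = ?y + z * ?y" by (simp add: algebra_simps)
  then have "norm (b + quasi_power z (Suc k) * b) \<le> (1 + (norm z)\<^sup>2) * norm ?y"
    using norm_one_plus_skew[OF assms] by metis
  also have "\<dots> \<le> (1 + (norm z)\<^sup>2) * ((1 + (norm z)\<^sup>2) ^ k * norm b)"
    by (intro mult_left_mono Suc) auto
  finally show ?case by (simp add: mult.assoc)
qed simp

lemma quasi_power_commute: "quasi_power z k * z = z * quasi_power z k"
  by (induction k) (simp_all add: algebra_simps)

lemma quasi_power_mem:
  "commutative_star_subalgebra J \<Longrightarrow> z \<in> J \<Longrightarrow> quasi_power z k \<in> J"
  by (induction k) (auto intro!: commutative_star_subalgebraD(5,6,2))

text \<open>Here \<open>1 - u\<close> is the Cesaro mean of the powers \<open>(1 + z)\<^sup>k\<close> with \<open>k < N\<close>. Multiplied by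
  \<open>z = (1 + z) - 1\<close>, the mean telescopes to \<open>((1 + z)\<^sup>N - 1) / N\<close>.\<close>

lemma mean_ergodic_quasi_power:
  fixes z :: "'a::cstar_algebra"
  assumes skew: "star z = - z" and N: "0 < N"
  defines "u \<equiv> scaleR (- (1 / real N)) (\<Sum>k<N. quasi_power z k)"
  defines "K \<equiv> (1 + (norm z)\<^sup>2) ^ N"
  shows "norm (b - u * b) \<le> K * norm b" and "norm (z - u * z) \<le> (K + 1) / real N"
proof -
  have K: "1 \<le> K" by (simp add: K_def)
  have mean: "b - u * b = scaleR (1 / real N) (\<Sum>k<N. b + quasi_power z k * b)" for b
    using N by (simp add: u_def sum.distrib scaleR_right_distrib sum_distrib_right sum_constant_scaleR)
  have "norm (\<Sum>k<N. b + quasi_power z k * b) \<le> of_nat (card {..<N}) * (K * norm b)"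
  proof (rule sum_norm_bound)
    fix k assume "k \<in> {..<N}"
    then have "(1 + (norm z)\<^sup>2) ^ k \<le> K" unfolding K_def by (intro power_increasing) auto
    then show "norm (b + quasi_power z k * b) \<le> K * norm b"
      using norm_quasi_power[OF skew, of b k] by (meson mult_right_mono norm_ge_zero order_trans)
  qed
  then show "norm (b - u * b) \<le> K * norm b"
    using N by (simp add: mean field_simps)
  have "z + quasi_power z k * z = quasi_power z (Suc k) - quasi_power z k" for k
    by (simp add: quasi_power_commute)
  then have "z - u * z = scaleR (1 / real N) (quasi_power z N)"
    using sum_lessThan_telescope[of "quasi_power z" N] by (simp only: mean) simp
  moreover have "norm (quasi_power z N) \<le> K + 1"
  proof (rule norm_le_mult_bound)
    fix b
    have "norm (quasi_power z N * b) \<le> norm (b + quasi_power z N * b) + norm b"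
      using norm_triangle_ineq4[of "b + quasi_power z N * b" b] by simp
    also have "\<dots> \<le> (K + 1) * norm b"
      using norm_quasi_power[OF skew, of b N] by (simp add: K_def algebra_simps)
    finally show "norm (quasi_power z N * b) \<le> (K + 1) * norm b" .
  qed (use K in simp)
  ultimately show "norm (z - u * z) \<le> (K + 1) / real N"
    using N by (simp add: divide_right_mono)
qed

text \<open>Apply the mean to \<open>z = i t s\<close> with a small real \<open>t\<close>, which is skew-adjoint.\<close>

lemma approximate_unit_selfadjoint:
  fixes s :: "'a::cstar_algebra"
  assumes J: "commutative_star_subalgebra J" and s: "s \<in> J" "star s = s"
    and \<eta>: "0 < \<eta>" and e: "0 < e"
  shows "\<exists>u\<in>J. (\<forall>b. norm (b - u * b) \<le> (1 + \<eta>) * norm b) \<and> norm (s - u * s) < e"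
proof -
  define c where "c = (norm s)\<^sup>2"
  have "((\<lambda>m. exp (c / real m)) \<longlonglongrightarrow> 1)"
    using tendsto_exp[OF lim_const_over_n[of c]] by simp
  then have ev1: "\<forall>\<^sub>F m in sequentially. exp (c / real m) < 1 + \<eta>"
    using \<eta> by (intro order_tendstoD(2)) auto
  have ev2: "\<forall>\<^sub>F m in sequentially. (2 + \<eta>) / real m < e"
    using lim_const_over_n[of "2 + \<eta>"] e by (intro order_tendstoD(2)) auto
  obtain m where m: "0 < m" "exp (c / real m) < 1 + \<eta>" "(2 + \<eta>) / real m < e"
    using eventually_happens[OF eventually_conj[OF eventually_conj[OF ev1 ev2] eventually_gt_at_top[of 0]]]
    by auto
  \<comment> \<open>With \<open>N = m\<^sup>3\<close> powers of step \<open>t = 1 / m\<^sup>2\<close>, the product \<open>N t\<^sup>2 = 1 / m\<close> keeps the powers almost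
    contractive, while the error of the mean, of order \<open>1 / (N t) = 1 / m\<close>, still vanishes.\<close>
  define t where "t = 1 / (real m)\<^sup>2"
  define N where "N = m ^ 3"
  define z where "z = scaleC (\<i> * complex_of_real t) s"
  define u where "u = scaleR (- (1 / real N)) (\<Sum>k<N. quasi_power z k)"
  define K where "K = (1 + (norm z)\<^sup>2) ^ N"
  have t: "0 < t" and N: "0 < N" using m by (auto simp: t_def N_def)
  have skew: "star z = - z"
    by (simp add: z_def star_scaleC s flip: complex_vector.scale_minus_left)
  have zJ: "z \<in> J" unfolding z_def by (intro commutative_star_subalgebraD[OF J] s)
  have norm_z: "norm z = t * norm s" using t by (simp add: z_def norm_scaleC norm_mult)
  have "real N * (norm z)\<^sup>2 = c / real m"
    using m(1) by (simp add: norm_z N_def t_def c_def power_mult_distrib power2_eq_square power3_eq_cube field_simps)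
  then have "K \<le> exp (c / real m)"
    using power_mono[OF exp_ge_add_one_self[of "(norm z)\<^sup>2"], of N]
    by (simp add: K_def flip: exp_of_nat_mult)
  then have K: "K < 1 + \<eta>" using m by simp
  note mean = mean_ergodic_quasi_power[OF skew N, folded u_def K_def]
  have uJ: "u \<in> J" unfolding u_def
    by (intro commutative_star_subalgebraD(9)[OF J]
        complex_vector.subspace_sum[OF commutative_star_subalgebraD(1)[OF J]] quasi_power_mem[OF J zJ])
  have "norm (b - u * b) \<le> (1 + \<eta>) * norm b" for b
    using mean(1)[of b] K by (meson less_imp_le mult_right_mono norm_ge_zero order_trans)
  moreover have "norm (s - u * s) < e"
  proof -
    have "z - u * z = scaleC (\<i> * complex_of_real t) (s - u * s)"
      by (simp add: z_def scaleC_diff_right mult_scaleC_right)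
    then have "t * norm (s - u * s) = norm (z - u * z)"
      using t by (simp add: norm_scaleC norm_mult)
    also have "\<dots> \<le> (2 + \<eta>) / real N" using K by (intro order_trans[OF mean(2)] divide_right_mono) auto
    also have "\<dots> = t * ((2 + \<eta>) / real m)"
      using m(1) by (simp add: N_def t_def power2_eq_square power3_eq_cube)
    finally have "norm (s - u * s) \<le> (2 + \<eta>) / real m"
      by (rule mult_left_le_imp_le[OF _ t])
    then show ?thesis using m by simp
  qed
  ultimately show ?thesis using uJ by blast
qed

lemma norm_le_of_almost_contraction:
  fixes u :: "'a::cstar_algebra"
  assumes "\<And>b. norm (b - u * b) \<le> K * norm b" "0 \<le> K"
  shows "norm u \<le> K + 1"
proof (rule norm_le_mult_bound)
  fix b show "norm (u * b) \<le> (K + 1) * norm b"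
    using assms(1)[of b] norm_triangle_ineq4[of b "b - u * b"] by (simp add: algebra_simps)
qed (use assms in simp)

lemma approximate_unit_element:
  fixes j :: "'a::cstar_algebra"
  assumes J: "commutative_star_subalgebra J" and j: "j \<in> J" and \<eta>: "0 < \<eta>" "\<eta> \<le> 1" and e: "0 < e"
  shows "\<exists>u\<in>J. (\<forall>b. norm (b - u * b) \<le> (1 + \<eta>) * norm b) \<and> norm (j - u * j) < e"
proof -
  note JD = commutative_star_subalgebraD[OF J]
  define s where "s = star j * j"
  have s: "s \<in> J" "star s = s" using JD j by (auto simp: s_def star_mult star_star)
  obtain u where u: "u \<in> J" "\<forall>b. norm (b - u * b) \<le> (1 + \<eta>) * norm b" "norm (s - u * s) < e\<^sup>2 / 4"
    using approximate_unit_selfadjoint[OF J s \<eta>(1), of "e\<^sup>2 / 4"] e by auto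
  have nu: "norm u \<le> 3"
    using norm_le_of_almost_contraction[of u "1 + \<eta>"] u \<eta> by auto
  have uj: "u * j = j * u" and us: "u * s = s * u" using JD(4) u j s by auto
  have "star (j - u * j) * (j - u * j) = (s - u * s) - star u * (s - u * s)"
    unfolding uj us by (simp add: s_def star_diff star_mult algebra_simps)
  then have "(norm (j - u * j))\<^sup>2 \<le> norm (s - u * s) + norm (star u * (s - u * s))"
    by (metis cstar_identity norm_triangle_ineq4)
  also have "\<dots> \<le> norm (s - u * s) + 3 * norm (s - u * s)"
  proof (intro add_left_mono order_trans[OF norm_mult_ineq] mult_right_mono)
    show "norm (star u) \<le> 3" using nu by simp
  qed simp
  also have "\<dots> < e\<^sup>2" using u(3) by simp
  finally have "norm (j - u * j) < e" using e by (intro power_less_imp_less_base[of _ 2 e]) auto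
  then show ?thesis using u by blast
qed

text \<open>If \<open>1 - u\<close> handles \<open>S\<close> and \<open>1 - v\<close> handles \<open>j\<close>, then their product \<open>1 - w\<close> with
  \<open>w = u + v - uv\<close> handles both, since the factors commute and are almost contractions. The
  parameter \<open>\<eta>\<close> keeps the norm of the product bounded independently of the size of \<open>S\<close>.\<close>

lemma approximate_unit_finite:
  fixes S :: "'a::cstar_algebra set"
  assumes J: "commutative_star_subalgebra J" and "finite S" "S \<subseteq> J"
    and "0 < \<eta>" "\<eta> \<le> 1" "0 < e"
  shows "\<exists>u\<in>J. (\<forall>b. norm (b - u * b) \<le> (1 + \<eta>) * norm b) \<and> (\<forall>j\<in>S. norm (j - u * j) < e)"
  using assms(2-)
proof (induction S arbitrary: \<eta> e rule: finite_induct)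
  case empty
  show ?case using commutative_star_subalgebraD(5)[OF J] empty
    by (intro bexI[of _ 0]) (auto simp: algebra_simps)
next
  case (insert j S)
  note JD = commutative_star_subalgebraD[OF J]
  have \<eta>: "0 < \<eta> / 3" "\<eta> / 3 \<le> 1" and e: "0 < e / 2" using insert.prems by auto
  obtain u where u: "u \<in> J" "\<And>b. norm (b - u * b) \<le> (1 + \<eta> / 3) * norm b"
      "\<And>i. i \<in> S \<Longrightarrow> norm (i - u * i) < e / 2"
    using insert.IH[OF _ \<eta> e] insert.prems by auto
  obtain v where v: "v \<in> J" "\<And>b. norm (b - v * b) \<le> (1 + \<eta> / 3) * norm b" "norm (j - v * j) < e / 2"
    using approximate_unit_element[OF J _ \<eta> e, of j] insert.prems by auto
  define w where "w = u + v - u * v"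
  have "u * v = v * u" using JD(4) u v by blast
  then have w1: "b - w * b = (b - v * b) - u * (b - v * b)"
    and w2: "b - w * b = (b - u * b) - v * (b - u * b)" for b
    by (simp_all add: w_def algebra_simps flip: mult.assoc)
  have wJ: "w \<in> J" using JD u v by (simp add: w_def)
  have "norm (b - w * b) \<le> (1 + \<eta>) * norm b" for b
  proof -
    have "norm (b - w * b) \<le> (1 + \<eta> / 3) * norm (b - v * b)" unfolding w1 by (rule u)
    also have "\<dots> \<le> (1 + \<eta> / 3) * ((1 + \<eta> / 3) * norm b)" using \<eta> by (intro mult_left_mono v) auto
    also have "\<dots> = (1 + \<eta> / 3) * (1 + \<eta> / 3) * norm b" by simp
    also have "\<dots> \<le> (1 + \<eta>) * norm b"
    proof (intro mult_right_mono)
      have "\<eta> * \<eta> \<le> \<eta> * 1" using insert.prems by (intro mult_left_mono) auto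
      then have "\<eta> * \<eta> / 9 + \<eta> * 2 / 3 \<le> \<eta>" using \<eta>(1) by linarith
      then show "(1 + \<eta> / 3) * (1 + \<eta> / 3) \<le> 1 + \<eta>" by (simp add: algebra_simps)
    qed simp
    finally show ?thesis .
  qed
  moreover have "norm (i - w * i) < e" if "i \<in> insert j S" for i
  proof -
    have half: "(1 + \<eta> / 3) * d < e" if "d < e / 2" "0 \<le> d" for d
    proof -
      have "(1 + \<eta> / 3) * d \<le> 2 * d" using that \<eta> by (intro mult_right_mono) auto
      then show ?thesis using that by simp
    qed
    show ?thesis
    proof (cases "i = j")
      case True
      then show ?thesis using u(2)[of "j - v * j"] half[OF v(3)] by (simp add: w1)
    next
      case False
      then have "norm (i - u * i) < e / 2" using u(3) that by auto
      then show ?thesis using v(2)[of "i - u * i"] half[of "norm (i - u * i)"] by (simp add: w2)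
    qed
  qed
  ultimately show ?case using wJ by blast
qed

text \<open>The tails of an approximate unit of \<open>J\<close>, indexed by finite subsets of \<open>J\<close> and tolerances. The
  bound \<open>3\<close> comes from \<open>\<parallel>u\<parallel> \<le> (1 + \<eta>) + 1\<close> with \<open>\<eta> \<le> 1\<close>.\<close>

definition ideal_unit_filter :: "'a::cstar_algebra set \<Rightarrow> 'a filter" where
  "ideal_unit_filter J = (INF (j, e)\<in>J \<times> {0<..}. principal {u \<in> J. norm u \<le> 3 \<and> norm (j - u * j) < e})"

lemma ideal_unit_filter_not_bot:
  assumes J: "commutative_star_subalgebra J"
  shows "ideal_unit_filter J \<noteq> bot"
  unfolding ideal_unit_filter_def
proof (rule INF_filter_not_bot)
  fix D :: "('a \<times> real) set" assume D: "D \<subseteq> J \<times> {0<..}" "finite D"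
  define e where "e = Min (insert 1 (snd ` D))"
  have e: "0 < e" "\<And>d. d \<in> D \<Longrightarrow> e \<le> snd d" using D by (auto simp: e_def)
  obtain u where u: "u \<in> J" "\<And>b. norm (b - u * b) \<le> (1 + 1) * norm b"
      "\<And>j. j \<in> fst ` D \<Longrightarrow> norm (j - u * j) < e"
    using approximate_unit_finite[OF J, of "fst ` D" 1 e] D e by fastforce
  have "norm u \<le> 3" using norm_le_of_almost_contraction[of u "1 + 1"] u by simp
  then have "u \<in> (\<Inter>(j, e)\<in>D. {u \<in> J. norm u \<le> 3 \<and> norm (j - u * j) < e})"
    using u e(2) by fastforce
  then show "(INF (j, e)\<in>D. principal {u \<in> J. norm u \<le> 3 \<and> norm (j - u * j) < e}) \<noteq> bot"
    using INF_principal_finite[OF D(2), of "\<lambda>(j, e). {u \<in> J. norm u \<le> 3 \<and> norm (j - u * j) < e}"]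
    by (auto simp: principal_eq_bot_iff case_prod_unfold)
qed

lemma eventually_ideal_unit_filter:
  assumes "j \<in> J" "0 < e"
  shows "\<forall>\<^sub>F u in ideal_unit_filter J. u \<in> J \<and> norm u \<le> 3 \<and> norm (j - u * j) < e"
proof -
  have "ideal_unit_filter J \<le> principal {u \<in> J. norm u \<le> 3 \<and> norm (j - u * j) < e}"
    unfolding ideal_unit_filter_def
    using INF_lower[of "(j, e)" "J \<times> {0<..}" "\<lambda>(j, e). principal {u \<in> J. norm u \<le> 3 \<and> norm (j - u * j) < e}"]
      assms by auto
  then show ?thesis by (auto simp: le_principal)
qed

lemma ideal_unit_filter_bound:
  assumes "commutative_star_subalgebra J"
  shows "\<forall>\<^sub>F u in ideal_unit_filter J. u \<in> J \<and> norm u \<le> 3"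
  using eventually_ideal_unit_filter[OF commutative_star_subalgebraD(5)[OF assms] zero_less_one]
  by (rule eventually_mono) auto

lemma ideal_unit_filter_base:
  assumes "j \<in> J" shows "((\<lambda>u. j - u * j) \<longlongrightarrow> 0) (ideal_unit_filter J)"
  by (rule tendstoI) (auto dest!: eventually_ideal_unit_filter[OF assms] elim: eventually_mono)

lemma norm_diff_mult_le_left:
  fixes b :: "'a::cstar_algebra"
  assumes "norm u \<le> 3" shows "norm (b - u * b) \<le> 4 * norm b"
proof -
  have "norm (u * b) \<le> 3 * norm b"
    using norm_mult_ineq[of u b] mult_right_mono[OF assms norm_ge_zero[of b]] by linarith
  then show ?thesis using norm_triangle_ineq4[of b "u * b"] by linarith
qed

lemma norm_diff_mult_le_right:
  fixes b :: "'a::cstar_algebra"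
  assumes "norm u \<le> 3" shows "norm (b - b * u) \<le> 4 * norm b"
  using norm_diff_mult_le_left[of "star u" "star b"] assms norm_star[of "b - b * u"]
  by (simp add: star_diff star_mult)

lemma ideal_unit_left:
  assumes J: "commutative_star_subalgebra J" and b: "b \<in> sprod J UNIV"
  shows "((\<lambda>u. b - u * b) \<longlongrightarrow> 0) (ideal_unit_filter J)"
proof -
  have "sprod J UNIV \<subseteq> {b. ((\<lambda>u. b - u * b) \<longlongrightarrow> 0) (ideal_unit_filter J)}"
  proof (rule sprod_minimal)
    show "closed_csubspace {b. ((\<lambda>u. b - u * b) \<longlongrightarrow> 0) (ideal_unit_filter J)}"
      by (rule closed_csubspace_tendsto_zero[where K=4])
        (auto simp: distrib_left mult_scaleC_right scaleC_diff_right
          intro!: eventually_mono[OF ideal_unit_filter_bound[OF J]] norm_diff_mult_le_left)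
    fix j b :: 'a assume "j \<in> J"
    from tendsto_mult_left_zero[OF ideal_unit_filter_base[OF this], of b]
    show "j * b \<in> {b. ((\<lambda>u. b - u * b) \<longlongrightarrow> 0) (ideal_unit_filter J)}"
      by (simp add: algebra_simps)
  qed
  then show ?thesis using b by auto
qed

lemma ideal_unit_right:
  assumes J: "commutative_star_subalgebra J" and b: "b \<in> sprod UNIV J"
  shows "((\<lambda>u. b - b * u) \<longlongrightarrow> 0) (ideal_unit_filter J)"
proof -
  have "sprod UNIV J \<subseteq> {b. ((\<lambda>u. b - b * u) \<longlongrightarrow> 0) (ideal_unit_filter J)}"
  proof (rule sprod_minimal)
    show "closed_csubspace {b. ((\<lambda>u. b - b * u) \<longlongrightarrow> 0) (ideal_unit_filter J)}"
      by (rule closed_csubspace_tendsto_zero[where K=4])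
        (auto simp: distrib_right mult_scaleC_left scaleC_diff_right
          intro!: eventually_mono[OF ideal_unit_filter_bound[OF J]] norm_diff_mult_le_right)
    fix b j :: 'a assume j: "j \<in> J"
    have "((\<lambda>u. b * (j - u * j)) \<longlongrightarrow> 0) (ideal_unit_filter J)"
      by (rule tendsto_mult_right_zero[OF ideal_unit_filter_base[OF j]])
    moreover have "\<forall>\<^sub>F u in ideal_unit_filter J. b * (j - u * j) = b * j - b * j * u"
      using ideal_unit_filter_bound[OF J]
      by (rule eventually_mono)
        (simp add: algebra_simps commutative_star_subalgebraD(4)[OF J j])
    ultimately show "b * j \<in> {b. ((\<lambda>u. b - b * u) \<longlongrightarrow> 0) (ideal_unit_filter J)}"
      using tendsto_cong by fastforce
  qed
  then show ?thesis using b by auto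
qed

lemma mem_sprod_right_ideal_unit:
  assumes J: "commutative_star_subalgebra J"
    and lim: "((\<lambda>u. b - b * u) \<longlongrightarrow> 0) (ideal_unit_filter J)"
  shows "b \<in> sprod UNIV J"
proof (rule Lim_in_closed_set)
  show "closed (sprod UNIV J)" using closed_csubspace_sprod[of UNIV J] unfolding closed_csubspace_def by blast
  show "\<forall>\<^sub>F u in ideal_unit_filter J. b * u \<in> sprod UNIV J"
    using ideal_unit_filter_bound[OF J] by (rule eventually_mono) (simp add: mult_mem_sprod)
  show "((\<lambda>u. b * u) \<longlongrightarrow> b) (ideal_unit_filter J)"
    using tendsto_diff[OF tendsto_const[of b] lim] by simp
qed (rule ideal_unit_filter_not_bot[OF J])

lemma subalgebra_subset_sprod:
  assumes J: "commutative_star_subalgebra J"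
  shows "J \<subseteq> sprod J UNIV" "J \<subseteq> sprod UNIV J"
proof -
  show r: "J \<subseteq> sprod UNIV J"
  proof
    fix j assume j: "j \<in> J"
    have "\<forall>\<^sub>F u in ideal_unit_filter J. j - u * j = j - j * u"
      using ideal_unit_filter_bound[OF J] 
      by (rule eventually_mono) (simp add: commutative_star_subalgebraD(4)[OF J j])
    then have "((\<lambda>u. j - j * u) \<longlongrightarrow> 0) (ideal_unit_filter J)"
      using ideal_unit_filter_base[OF j] tendsto_cong by fastforce
    then show "j \<in> sprod UNIV J" by (rule mem_sprod_right_ideal_unit[OF J])
  qed
  show "J \<subseteq> sprod J UNIV"
  proof
    fix j assume "j \<in> J"
    then have "star j \<in> sprod UNIV J" using r commutative_star_subalgebraD(3)[OF J] by blast
    then show "j \<in> sprod J UNIV"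
      using star_mem_sprod_left commutative_star_subalgebraD(3)[OF J] star_star by metis
  qed
qed

text \<open>The expression is \<open>(1 - u*)z(1 - u)\<close>: the right factor kills \<open>BJ\<close> and the left factor kills
  \<open>JB\<close>, while the other one stays bounded.\<close>

lemma ideal_unit_two_sided:
  assumes J: "commutative_star_subalgebra J" and z: "z \<in> ssum (sprod J UNIV) (sprod UNIV J)"
  shows "((\<lambda>u. (z - z * u) - star u * (z - z * u)) \<longlongrightarrow> 0) (ideal_unit_filter J)"
proof -
  let ?U = "ideal_unit_filter J"
  let ?F = "\<lambda>u z. (z - z * u) - star u * (z - z * u)"
  let ?M = "{z. ((\<lambda>u. ?F u z) \<longlongrightarrow> 0) ?U}"
  note JD = commutative_star_subalgebraD[OF J]
  have small: "((\<lambda>u. p u - star u * p u) \<longlongrightarrow> 0) ?U" if "(p \<longlongrightarrow> 0) ?U" for p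
  proof (rule tendsto_0_le[OF that, where K=4])
    show "\<forall>\<^sub>F u in ?U. norm (p u - star u * p u) \<le> norm (p u) * 4"
      using ideal_unit_filter_bound[OF J]
      by (rule eventually_mono) (simp add: mult.commute[of _ 4] norm_diff_mult_le_left)
  qed
  have "ssum (sprod J UNIV) (sprod UNIV J) \<subseteq> ?M"
  proof (rule ssum_minimal)
    show "closed_csubspace ?M"
    proof (rule closed_csubspace_tendsto_zero[where K=16])
      show "\<forall>\<^sub>F u in ?U. \<forall>b. norm (?F u b) \<le> 16 * norm b"
        using ideal_unit_filter_bound[OF J]
      proof (rule eventually_mono, intro allI)
        fix u b assume "u \<in> J \<and> norm u \<le> 3"
        then show "norm (?F u b) \<le> 16 * norm b"
          using norm_diff_mult_le_left[of "star u" "b - b * u"] norm_diff_mult_le_right[of u b] by simp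
      qed
    qed (auto simp: algebra_simps mult_scaleC_right mult_scaleC_left scaleC_diff_right scaleC_add_right)
    show "sprod UNIV J \<subseteq> ?M" using small[OF ideal_unit_right[OF J]] by auto
    show "sprod J UNIV \<subseteq> ?M"
    proof
      fix p assume "p \<in> sprod J UNIV"
      then have "star p \<in> sprod UNIV J" using star_mem_sprod_right JD(3) by metis
      from tendsto_star[OF ideal_unit_right[OF J this]]
      have lim: "((\<lambda>u. p - star u * p) \<longlongrightarrow> 0) ?U" by (simp add: star_diff star_mult star_star)
      have "((\<lambda>u. (p - star u * p) - (p - star u * p) * u) \<longlongrightarrow> 0) ?U"
      proof (rule tendsto_0_le[OF lim, where K=4])
        show "\<forall>\<^sub>F u in ?U. norm ((p - star u * p) - (p - star u * p) * u) \<le> norm (p - star u * p) * 4"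
          using ideal_unit_filter_bound[OF J]
          by (rule eventually_mono) (simp add: mult.commute[of _ 4] norm_diff_mult_le_right)
      qed
      then show "p \<in> ?M" by (simp add: algebra_simps)
    qed
  qed
  then show ?thesis using z by auto
qed

text \<open>By the C*-identity \<open>\<parallel>b - bu\<parallel>\<^sup>2 = \<parallel>(1 - u*)b*b(1 - u)\<parallel>\<close>, and the right-hand side tends to zero.\<close>

lemma mem_sprod_of_star_mult_mem_ssum:
  assumes J: "commutative_star_subalgebra J"
    and z: "star b * b \<in> ssum (sprod J UNIV) (sprod UNIV J)"
  shows "b \<in> sprod UNIV J"
proof (rule mem_sprod_right_ideal_unit[OF J])
  let ?z = "star b * b"
  have "star (b - b * u) * (b - b * u) = (?z - ?z * u) - star u * (?z - ?z * u)" for u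
    by (simp add: star_diff star_mult algebra_simps)
  then have "((\<lambda>u. (norm (b - b * u))\<^sup>2) \<longlongrightarrow> 0) (ideal_unit_filter J)"
    using tendsto_norm_zero[OF ideal_unit_two_sided[OF J z]] by (simp add: cstar_identity[symmetric])
  from tendsto_real_sqrt[OF this] show "((\<lambda>u. b - b * u) \<longlongrightarrow> 0) (ideal_unit_filter J)"
    by (simp add: tendsto_norm_zero_iff)
qed

lemma mem_sprod_right_of_star_mult:
  assumes J: "commutative_star_subalgebra J" and b: "star b * b \<in> J"
  shows "b \<in> sprod UNIV J"
  using mem_sprod_of_star_mult_mem_ssum[OF J] ssum_superset(1)[of "sprod J UNIV" "sprod UNIV J"]
    subalgebra_subset_sprod(1)[OF J] b by auto

section \<open>The localizing projections as quotient maps\<close>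

text \<open>The bound says that every element of \<open>C + L\<close> has a decomposition whose \<open>C\<close>-part is controlled
  by its norm. A limit of elements of \<open>C + L\<close> is the sum of a rapidly converging series of
  differences; decomposing the terms, the \<open>C\<close>-parts sum up in \<open>C\<close> and the rest stays in \<open>L\<close>.\<close>

lemma closed_sum_of_subspaces:
  fixes C L :: "'a::cstar_algebra set"
  assumes C: "closed_csubspace C" and L: "closed_csubspace L"
    and split: "\<And>c l. c \<in> C \<Longrightarrow> l \<in> L \<Longrightarrow> \<exists>h\<in>C \<inter> L. norm (c - h) \<le> K * norm (c + l)"
  shows "closed {c + l | c l. c \<in> C \<and> l \<in> L}" (is "closed ?S")
proof -
  note CD = closed_csubspaceD[OF C] and LD = closed_csubspaceD[OF L]
  have sub: "csubspace ?S" using complex_vector.subspace_sums CD(2) LD(2) by blast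
  have decomp: "\<exists>c\<in>C. d - c \<in> L \<and> norm c \<le> K * norm d" if "d \<in> ?S" for d
  proof -
    obtain c l where cl: "c \<in> C" "l \<in> L" "d = c + l" using \<open>d \<in> ?S\<close> by auto
    obtain h where h: "h \<in> C" "h \<in> L" "norm (c - h) \<le> K * norm d" using split[OF cl(1,2)] cl by auto
    then show ?thesis using cl CD(5)[of c h] LD(4)[of l h]
      by (intro bexI[of _ "c - h"]) (auto simp: algebra_simps)
  qed
  have "b \<in> ?S" if b: "b \<in> closure ?S" for b
  proof -
    have "\<forall>n::nat. \<exists>q. q \<in> ?S \<and> dist q b < (1/2) ^ n"
      using b unfolding closure_approachable Bex_def by (intro allI) (simp only: zero_less_power half_gt_zero zero_less_one)
    from choice[OF this] obtain q where q: "\<And>n. q n \<in> ?S" "\<And>n::nat. dist (q n) b < (1/2) ^ n" by blast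
    have q_lim: "q \<longlonglongrightarrow> b"
      by (rule metric_tendsto_imp_tendsto[of "\<lambda>n. (1/2::real) ^ n" 0])
        (use q(2) in \<open>auto intro!: LIMSEQ_power_zero always_eventually less_imp_le\<close>)
    define d where "d n = q (Suc n) - q n" for n
    have "d n \<in> ?S" for n unfolding d_def by (intro complex_vector.subspace_diff sub q)
    then have "\<forall>n. \<exists>c. c \<in> C \<and> d n - c \<in> L \<and> norm c \<le> K * norm (d n)"
      using decomp by blast
    from choice[OF this]
    obtain c where c: "\<And>n. c n \<in> C" "\<And>n. d n - c n \<in> L" "\<And>n. norm (c n) \<le> K * norm (d n)"
      by blast
    have nd: "norm (d n) \<le> 2 * (1/2) ^ n" for n
    proof -
      have "norm (d n) \<le> dist (q (Suc n)) b + dist (q n) b"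
        using dist_triangle2[of "q (Suc n)" "q n" b] by (simp add: d_def dist_norm)
      also have "\<dots> \<le> (1/2) ^ Suc n + (1/2) ^ n"
        by (intro add_mono less_imp_le q(2))
      also have "\<dots> \<le> 2 * (1/2) ^ n" by simp
      finally show ?thesis .
    qed
    have "norm (c n) \<le> \<bar>K\<bar> * (2 * (1/2) ^ n)" for n
    proof -
      have "norm (c n) \<le> \<bar>K\<bar> * norm (d n)"
        by (rule order_trans[OF c(3)]) (intro mult_right_mono, auto)
      also have "\<dots> \<le> \<bar>K\<bar> * (2 * (1/2) ^ n)" by (intro mult_left_mono nd) auto
      finally show ?thesis .
    qed
    then have "summable c"
      by (intro summable_comparison_test'[of "\<lambda>n. \<bar>K\<bar> * (2 * (1/2) ^ n)" 0 c])
        (auto intro!: summable_mult summable_geometric)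
    then have c_lim: "(\<lambda>n. \<Sum>k<n. c k) \<longlonglongrightarrow> suminf c" by (rule summable_LIMSEQ)
    have "suminf c \<in> C"
      by (rule Lim_in_closed_set[OF CD(1) _ _ c_lim]) (auto intro!: CD(8) c always_eventually)
    moreover have "b - q 0 - suminf c \<in> L"
    proof (rule Lim_in_closed_set[OF LD(1)])
      show "(\<lambda>n. q n - q 0 - (\<Sum>k<n. c k)) \<longlonglongrightarrow> b - q 0 - suminf c"
        by (intro tendsto_intros q_lim c_lim)
      have "q n - q 0 - (\<Sum>k<n. c k) = (\<Sum>k<n. d k - c k)" for n
        using sum_lessThan_telescope[of q n] by (simp add: d_def sum_subtractf)
      then show "\<forall>\<^sub>F n in sequentially. q n - q 0 - (\<Sum>k<n. c k) \<in> L"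
        by (auto intro!: LD(8) c always_eventually)
    qed auto
    moreover obtain c0 l0 where "c0 \<in> C" "l0 \<in> L" "q 0 = c0 + l0" using q(1)[of 0] by auto
    moreover have "b = (c0 + suminf c) + (l0 + (b - q 0 - suminf c))"
      using \<open>q 0 = c0 + l0\<close> by simp
    ultimately show "b \<in> ?S" using CD(4) LD(4) by blast
  qed
  then show ?thesis using closure_subset_eq by blast
qed

lemma closed_csubspace_C_space: "closed_csubspace (C_space A y x)"
proof -
  have "C_space A y x = (\<Inter>j\<in>point_ideal A x. (\<lambda>c. c * j) -` sprod (point_ideal A y) UNIV) \<inter>
      (\<Inter>j\<in>point_ideal A y. (\<lambda>c. j * c) -` sprod UNIV (point_ideal A x))"
    by (auto simp: C_space_def)
  then show ?thesis
    by (simp add: closed_csubspace_Int closed_csubspace_INT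
        closed_csubspace_vimage_left closed_csubspace_vimage_right)
qed

lemma closed_csubspace_H_space: "closed_csubspace (H_space A y x)"
  by (simp add: H_space_def)

lemma closed_csubspace_L_space: "closed_csubspace (L_space A y x)"
  by (simp add: L_space_def)

lemma coset_eq_iff:
  assumes "closed_csubspace W" shows "coset W a = coset W b \<longleftrightarrow> a - b \<in> W"
proof
  note WD = closed_csubspaceD[OF assms]
  assume "coset W a = coset W b"
  moreover have "a \<in> coset W a" using WD(3) by (force simp: coset_def)
  ultimately show "a - b \<in> W" by (auto simp: coset_def)
next
  note WD = closed_csubspaceD[OF assms]
  have sub: "coset W a \<subseteq> coset W b" if "a - b \<in> W" for a b
  proof
    fix z assume "z \<in> coset W a"
    then obtain w where "w \<in> W" "z = b + ((a - b) + w)" by (auto simp: coset_def)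
    then show "z \<in> coset W b" using WD(4) that unfolding coset_def by blast
  qed
  assume "a - b \<in> W"
  moreover from WD(6)[OF this] have "b - a \<in> W" by simp
  ultimately show "coset W a = coset W b" using sub by blast
qed

context
  fixes A :: "'a::cstar_algebra set" and x y :: "'a \<Rightarrow> complex"
  assumes Jx: "commutative_star_subalgebra (point_ideal A x)"
    and Jy: "commutative_star_subalgebra (point_ideal A y)"
begin

lemma C_space_bimodule:
  assumes c: "c \<in> C_space A y x"
  shows "k \<in> point_ideal A y \<Longrightarrow> k * c \<in> C_space A y x"
    and "j \<in> point_ideal A x \<Longrightarrow> c * j \<in> C_space A y x"
proof -
  have cx: "c * i \<in> sprod (point_ideal A y) UNIV" if "i \<in> point_ideal A x" for i
    using c that by (simp add: C_space_def)
  have cy: "i * c \<in> sprod UNIV (point_ideal A x)" if "i \<in> point_ideal A y" for i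
    using c that by (simp add: C_space_def)
  note mx = commutative_star_subalgebraD(2)[OF Jx] and my = commutative_star_subalgebraD(2)[OF Jy]
  show "k * c \<in> C_space A y x" if k: "k \<in> point_ideal A y"
  proof -
    have "k * c * i \<in> sprod (point_ideal A y) UNIV" if "i \<in> point_ideal A x" for i
      unfolding mult.assoc by (rule sprod_left_module[OF my[OF k] cx[OF that]])
    moreover have "i * (k * c) \<in> sprod UNIV (point_ideal A x)" if "i \<in> point_ideal A y" for i
      by (rule sprod_UNIV_left_ideal[OF cy[OF k]])
    ultimately show ?thesis by (simp add: C_space_def)
  qed
  show "c * j \<in> C_space A y x" if j: "j \<in> point_ideal A x"
  proof -
    have "i * (c * j) \<in> sprod UNIV (point_ideal A x)" if "i \<in> point_ideal A y" for i
      unfolding mult.assoc[symmetric] by (rule sprod_right_module[OF mx[OF _ j] cy[OF that]])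
    moreover have "c * j * i \<in> sprod (point_ideal A y) UNIV" if "i \<in> point_ideal A x" for i
      by (rule sprod_UNIV_right_ideal[OF cx[OF j]])
    ultimately show ?thesis by (simp add: C_space_def)
  qed
qed

lemma H_space_subset: "H_space A y x \<subseteq> C_space A y x" "H_space A y x \<subseteq> L_space A y x"
proof -
  show "H_space A y x \<subseteq> C_space A y x"
    unfolding H_space_def
    by (rule sprod_minimal) (auto intro: closed_csubspace_C_space C_space_bimodule)
  have "H_space A y x \<subseteq> sprod (point_ideal A y) UNIV"
    unfolding H_space_def by (rule sprod_minimal) (auto intro: mult_mem_sprod)
  also have "\<dots> \<subseteq> L_space A y x" unfolding L_space_def by (intro ssum_superset) auto
  finally show "H_space A y x \<subseteq> L_space A y x" .
qed

text \<open>This is the inclusion \<open>C\<^sub>y\<^sub>xJ\<^sub>x \<subseteq> J\<^sub>yC\<^sub>y\<^sub>x\<close>: the element \<open>c j\<close> lies in \<open>C\<^sub>y\<^sub>x\<close> and in \<open>J\<^sub>yB\<close>, so it is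
  the limit of \<open>u (c j)\<close> along an approximate unit of \<open>J\<^sub>y\<close>.\<close>

lemma C_mult_point_ideal_mem_H:
  assumes c: "c \<in> C_space A y x" and j: "j \<in> point_ideal A x"
  shows "c * j \<in> H_space A y x"
proof (rule Lim_in_closed_set)
  let ?U = "ideal_unit_filter (point_ideal A y)"
  have cj: "c * j \<in> C_space A y x" "c * j \<in> sprod (point_ideal A y) UNIV"
    using C_space_bimodule(2)[OF c j] c j by (auto simp: C_space_def)
  show "\<forall>\<^sub>F u in ?U. u * (c * j) \<in> H_space A y x"
    using ideal_unit_filter_bound[OF Jy]
    by (rule eventually_mono) (simp add: H_space_def mult_mem_sprod cj)
  show "((\<lambda>u. u * (c * j)) \<longlongrightarrow> c * j) ?U"
    using tendsto_diff[OF tendsto_const[of "c * j"] ideal_unit_left[OF Jy cj(2)]] by simp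
  show "closed (H_space A y x)" by (rule closed_csubspaceD[OF closed_csubspace_H_space])
qed (rule ideal_unit_filter_not_bot[OF Jy])

text \<open>The map \<open>f\<close> in the proof is \<open>w \<mapsto> (1 - u)w(1 - v)\<close> with \<open>u \<in> J\<^sub>y\<close> and \<open>v \<in> J\<^sub>x\<close>. It changes \<open>c\<close> only
  by an element of \<open>H\<^sub>y\<^sub>x\<close>, it nearly annihilates \<open>l\<close>, and its norm is at most \<open>4 \<cdot> 4\<close>.\<close>

lemma C_space_dist_H_space:
  assumes c: "c \<in> C_space A y x" and l: "l \<in> L_space A y x" and e: "0 < e"
  shows "\<exists>h\<in>H_space A y x. norm (c - h) \<le> 16 * norm (c - l) + e"
proof -
  have "0 < e / 32" using e by simp
  with l obtain s where s: "s \<in> {p + q | p q. p \<in> sprod (point_ideal A y) UNIV \<and>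
      q \<in> sprod UNIV (point_ideal A x)}" "dist s l < e / 32"
    unfolding L_space_def ssum_eq_closure[OF closed_csubspace_sprod closed_csubspace_sprod]
      closure_approachable by blast
  then obtain p q where pq: "p \<in> sprod (point_ideal A y) UNIV" "q \<in> sprod UNIV (point_ideal A x)"
      "norm (l - (p + q)) < e / 32"
    by (auto simp: dist_norm norm_minus_commute)
  have "\<forall>\<^sub>F u in ideal_unit_filter (point_ideal A y). norm (p - u * p) < e / 16"
    using tendstoD[OF ideal_unit_left[OF Jy pq(1)], of "e / 16"] e by simp
  from eventually_happens'[OF ideal_unit_filter_not_bot[OF Jy]
      eventually_conj[OF ideal_unit_filter_bound[OF Jy] this]]
  obtain u where u: "u \<in> point_ideal A y" "norm u \<le> 3" "norm (p - u * p) < e / 16" by blast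
  have "\<forall>\<^sub>F v in ideal_unit_filter (point_ideal A x). norm (q - q * v) < e / 16"
    using tendstoD[OF ideal_unit_right[OF Jx pq(2)], of "e / 16"] e by simp
  from eventually_happens'[OF ideal_unit_filter_not_bot[OF Jx]
      eventually_conj[OF ideal_unit_filter_bound[OF Jx] this]]
  obtain v where v: "v \<in> point_ideal A x" "norm v \<le> 3" "norm (q - q * v) < e / 16" by blast
  define f where "f w = (w - u * w) - (w - u * w) * v" for w
  define h where "h = u * c + (c * v - u * (c * v))"
  have cv: "c * v \<in> H_space A y x" by (rule C_mult_point_ideal_mem_H[OF c v(1)])
  have uH: "u * b \<in> H_space A y x" if "b \<in> C_space A y x" for b
    using u that by (simp add: H_space_def mult_mem_sprod)
  have h: "h \<in> H_space A y x"
    unfolding h_def using cv uH[OF c] uH C_space_bimodule(2)[OF c v(1)]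
    by (intro closed_csubspaceD(4,5)[OF closed_csubspace_H_space])
  have bound: "norm (f w) \<le> 16 * norm w" for w
    using norm_diff_mult_le_left[OF u(2), of w] norm_diff_mult_le_right[OF v(2), of "w - u * w"]
    by (simp add: f_def)
  have fp: "norm (f p) \<le> e / 4"
    using norm_diff_mult_le_right[OF v(2), of "p - u * p"] u(3) by (simp add: f_def)
  have "f q = (q - q * v) - u * (q - q * v)" by (simp add: f_def algebra_simps)
  then have fq: "norm (f q) \<le> e / 4"
    using norm_diff_mult_le_left[OF u(2), of "q - q * v"] v(3) by simp
  have "c - h = f (c - l) + f (l - (p + q)) + f p + f q"
    by (simp add: f_def h_def algebra_simps)
  also have "norm \<dots> \<le> 16 * norm (c - l) + 16 * (e / 32) + e / 4 + e / 4"
    by (intro norm_triangle_le add_mono bound fp fq order_trans[OF bound[of "l - (p + q)"]])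
      (use pq in simp)
  finally have "norm (c - h) \<le> 16 * norm (c - l) + e" by simp
  then show ?thesis using h by blast
qed

lemma C_Int_L_subset_H: "C_space A y x \<inter> L_space A y x \<subseteq> H_space A y x"
proof
  fix c assume c: "c \<in> C_space A y x \<inter> L_space A y x"
  have "c \<in> closure (H_space A y x)"
    unfolding closure_approachable
  proof (intro allI impI)
    fix e :: real assume "0 < e"
    then obtain h where "h \<in> H_space A y x" "norm (c - h) \<le> 16 * norm (c - c) + e / 2"
      using C_space_dist_H_space[of c c "e / 2"] c by auto
    then show "\<exists>h\<in>H_space A y x. dist h c < e"
      using \<open>0 < e\<close> by (intro bexI[of _ h]) (auto simp: dist_norm norm_minus_commute)
  qed
  then show "c \<in> H_space A y x"
    using closed_csubspaceD(1)[OF closed_csubspace_H_space] closure_closed by blast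
qed

lemma closed_csubspace_C_plus_L:
  "closed_csubspace {c + l | c l. c \<in> C_space A y x \<and> l \<in> L_space A y x}"
proof -
  have "closed {c + l | c l. c \<in> C_space A y x \<and> l \<in> L_space A y x}"
  proof (rule closed_sum_of_subspaces[where K=17])
    fix c l assume c: "c \<in> C_space A y x" and l: "l \<in> L_space A y x"
    note neg = closed_csubspaceD(6)[OF closed_csubspace_L_space]
    show "\<exists>h\<in>C_space A y x \<inter> L_space A y x. norm (c - h) \<le> 17 * norm (c + l)"
    proof (cases "c + l = 0")
      case True
      then have "c = - l" by (simp add: eq_neg_iff_add_eq_0)
      then show ?thesis using c neg[OF l] by (intro bexI[of _ c]) auto
    next
      case False
      then obtain h where "h \<in> H_space A y x" "norm (c - h) \<le> 16 * norm (c + l) + norm (c + l)"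
        using C_space_dist_H_space[OF c neg[OF l], of "norm (c + l)"] by auto
      then show ?thesis using H_space_subset by (intro bexI[of _ h]) auto
    qed
  qed (rule closed_csubspace_C_space closed_csubspace_L_space)+
  then show ?thesis
    unfolding closed_csubspace_def
    using complex_vector.subspace_sums closed_csubspaceD(2) closed_csubspace_C_space
      closed_csubspace_L_space by blast
qed

lemma Psi_coset: "Psi A y x (coset (H_space A y x) c) = coset (L_space A y x) c"
proof
  note LD = closed_csubspaceD[OF closed_csubspace_L_space[of A y x]]
  show "Psi A y x (coset (H_space A y x) c) \<subseteq> coset (L_space A y x) c"
  proof
    fix z assume "z \<in> Psi A y x (coset (H_space A y x) c)"
    then obtain h l where "h \<in> H_space A y x" "l \<in> L_space A y x" "z = c + (h + l)"
      by (auto simp: Psi_def coset_def add.assoc)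
    then show "z \<in> coset (L_space A y x) c"
      using LD(4)[of h l] H_space_subset(2) unfolding coset_def by blast
  qed
  have "c \<in> coset (H_space A y x) c"
    using closed_csubspaceD(3)[OF closed_csubspace_H_space[of A y x]] by (force simp: coset_def)
  then show "coset (L_space A y x) c \<subseteq> Psi A y x (coset (H_space A y x) c)"
    by (auto simp: Psi_def)
qed

end

text \<open>The hypothesis \<open>C + L = B\<close> makes \<open>Psi\<close> surjective and \<open>C \<inter> L \<subseteq> H\<close> makes it injective, so that the
  inverse in the definition of \<open>loc_proj\<close> is a genuine one.\<close>

lemma loc_proj_eq_zero_iff:
  assumes Jx: "commutative_star_subalgebra (point_ideal A x)"
    and Jy: "commutative_star_subalgebra (point_ideal A y)"
    and total: "\<And>b. \<exists>c\<in>C_space A y x. b - c \<in> L_space A y x"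
  shows "loc_proj A y x b = coset (H_space A y x) 0 \<longleftrightarrow> b \<in> L_space A y x"
proof -
  note C = closed_csubspace_C_space[of A y x] and H = closed_csubspace_H_space[of A y x]
    and L = closed_csubspace_L_space[of A y x]
  note Psi = Psi_coset[OF Jx Jy]
  have inj: "inj_on (Psi A y x) (localization A y x)"
  proof (rule inj_onI)
    fix \<xi> \<zeta> assume "\<xi> \<in> localization A y x" "\<zeta> \<in> localization A y x" "Psi A y x \<xi> = Psi A y x \<zeta>"
    moreover then obtain c d where cd: "c \<in> C_space A y x" "\<xi> = coset (H_space A y x) c"
        "d \<in> C_space A y x" "\<zeta> = coset (H_space A y x) d"
      by (auto simp: localization_def quotient_space_def)
    ultimately have "c - d \<in> L_space A y x" by (simp add: Psi coset_eq_iff[OF L])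
    then have "c - d \<in> H_space A y x"
      using C_Int_L_subset_H[OF Jx Jy] closed_csubspaceD(5)[OF C] cd by blast
    then show "\<xi> = \<zeta>" using cd by (simp add: coset_eq_iff[OF H])
  qed
  obtain c where c: "c \<in> C_space A y x" "b - c \<in> L_space A y x" using total by blast
  have mem: "coset (H_space A y x) d \<in> localization A y x" if "d \<in> C_space A y x" for d
    using that by (simp add: localization_def quotient_space_def)
  have "coset (L_space A y x) b = Psi A y x (coset (H_space A y x) c)"
    using c by (simp add: Psi coset_eq_iff[OF L])
  then have "loc_proj A y x b = coset (H_space A y x) c"
    unfolding loc_proj_def using inv_into_f_f[OF inj mem[OF c(1)]] by simp
  then have "loc_proj A y x b = coset (H_space A y x) 0 \<longleftrightarrow> c \<in> H_space A y x"
    by (simp add: coset_eq_iff[OF H])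
  also have "\<dots> \<longleftrightarrow> c \<in> L_space A y x"
    using C_Int_L_subset_H[OF Jx Jy] H_space_subset[OF Jx Jy] c by blast
  also have "\<dots> \<longleftrightarrow> b \<in> L_space A y x"
    using closed_csubspaceD(4)[OF L c(2), of c] closed_csubspaceD(5)[OF L _ c(2), of b] by auto
  finally show ?thesis .
qed

section \<open>Characters and the action of normalizers\<close>

text \<open>The power \<open>a\<^sup>k\<^sup>+\<^sup>1\<close>, shifted because the algebra need not have a unit.\<close>

primrec mult_power :: "'a::cstar_algebra \<Rightarrow> nat \<Rightarrow> 'a" where
  "mult_power a 0 = a"
| "mult_power a (Suc k) = a * mult_power a k"

lemma norm_mult_power: "norm (mult_power a k) \<le> norm a ^ Suc k"
proof (induction k)
  case (Suc k)
  have "norm (mult_power a (Suc k)) \<le> norm a * norm (mult_power a k)" by (simp add: norm_mult_ineq)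
  also have "\<dots> \<le> norm a * norm a ^ Suc k" by (intro mult_left_mono Suc) auto
  finally show ?case by simp
qed simp

lemma normalizer_star: "normalizer A n \<Longrightarrow> normalizer A (star n)"
  by (simp add: normalizer_def star_star)

text \<open>The image of \<open>x\<close> under the partial homeomorphism of the spectrum induced by \<open>n\<close>, whose domain
  consists of the \<open>x\<close> with \<open>x (star n * n) \<noteq> 0\<close>.\<close>

definition normalizer_action ::
  "'a::cstar_algebra set \<Rightarrow> 'a \<Rightarrow> ('a \<Rightarrow> complex) \<Rightarrow> 'a \<Rightarrow> complex" where
  "normalizer_action A n x = restrict (\<lambda>a. x (star n * a * n) / x (star n * n)) A"

locale abelian_inclusion =
  fixes A :: "'a::cstar_algebra set"
  assumes inclusion: "inclusion A"
    and approximate_unit: "contains_approximate_unit A"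
    and commute: "\<And>a b. a \<in> A \<Longrightarrow> b \<in> A \<Longrightarrow> a * b = b * a"
begin

lemma subalgebra: "commutative_star_subalgebra A"
  using inclusion commute by (auto simp: inclusion_def commutative_star_subalgebra_def)

lemmas A_closed = commutative_star_subalgebraD(2,3,6-9)[OF subalgebra]

lemma closed_csubspace_A: "closed_csubspace A"
  using inclusion by (simp add: inclusion_def closed_csubspace_def)

lemma approximate_unitE:
  obtains U :: "'a filter" where "U \<noteq> bot" "\<forall>\<^sub>F u in U. u \<in> A \<and> star u = u \<and> norm u \<le> 1"
    "\<And>b. ((\<lambda>u. u * b) \<longlongrightarrow> b) U" "\<And>b. ((\<lambda>u. b * u) \<longlongrightarrow> b) U"
proof -
  obtain U where U: "U \<noteq> bot" "\<forall>\<^sub>F u in U. u \<in> A \<and> positive_element u \<and> norm u \<le> 1"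
    "\<And>b. ((\<lambda>u. u * b) \<longlongrightarrow> b) U" "\<And>b. ((\<lambda>u. b * u) \<longlongrightarrow> b) U"
    using approximate_unit unfolding contains_approximate_unit_def by blast
  have "\<forall>\<^sub>F u in U. u \<in> A \<and> star u = u \<and> norm u \<le> 1"
    using U(2) by (rule eventually_mono) (auto simp: positive_element_def star_mult star_star)
  then show thesis using that U by blast
qed

lemma spectrumD:
  assumes "x \<in> spectrum A"
  shows "a \<in> A \<Longrightarrow> b \<in> A \<Longrightarrow> x (a + b) = x a + x b"
    and "a \<in> A \<Longrightarrow> x (scaleC c a) = c * x a"
    and "a \<in> A \<Longrightarrow> b \<in> A \<Longrightarrow> x (a * b) = x a * x b"
    and "a \<in> A \<Longrightarrow> b \<in> A \<Longrightarrow> x (a - b) = x a - x b"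
    and "\<exists>a\<in>A. x a \<noteq> 0"
proof -
  show add: "x (a + b) = x a + x b" if "a \<in> A" "b \<in> A" for a b
    using assms that by (simp add: spectrum_def)
  show "a \<in> A \<Longrightarrow> b \<in> A \<Longrightarrow> x (a - b) = x a - x b"
    using add[of "a - b" b] A_closed(4) by simp
qed (use assms in \<open>auto simp: spectrum_def\<close>)

text \<open>If \<open>x(c) = 1\<close> with \<open>\<parallel>c\<parallel> < 1\<close>, then \<open>b = c + c\<^sup>2 + \<dots>\<close> converges in \<open>A\<close> and satisfies
  \<open>c b = b - c\<close>; applying \<open>x\<close> gives \<open>x(b) = x(b) - 1\<close>.\<close>

lemma spectrum_norm_le:
  assumes x: "x \<in> spectrum A" and a: "a \<in> A"
  shows "cmod (x a) \<le> norm a"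
proof (rule ccontr)
  assume "\<not> cmod (x a) \<le> norm a"
  then have lt: "norm a < cmod (x a)" by simp
  then have nz: "x a \<noteq> 0" by auto
  define c where "c = scaleC (1 / x a) a"
  have c: "c \<in> A" "x c = 1" using a nz A_closed spectrumD(2)[OF x a] by (auto simp: c_def)
  have norm_c: "norm c < 1" using lt nz by (simp add: c_def norm_scaleC norm_divide)
  have "mult_power c k \<in> A" for k by (induction k) (auto intro: A_closed c)
  have sum: "summable (mult_power c)"
    by (rule summable_comparison_test'[of "\<lambda>k. norm c ^ Suc k" 0])
      (use norm_c norm_mult_power in \<open>auto intro: summable_mult summable_geometric\<close>)
  define b where "b = suminf (mult_power c)"
  have "b \<in> A" unfolding b_def
    by (rule Lim_in_closed_set[OF closed_csubspaceD(1)[OF closed_csubspace_A] _ _ summable_LIMSEQ[OF sum]])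
      (auto intro!: always_eventually closed_csubspaceD(8)[OF closed_csubspace_A] \<open>\<And>k. mult_power c k \<in> A\<close>)
  have "c * b = (\<Sum>k. mult_power c (Suc k))"
    using suminf_mult[OF sum, of c] by (simp add: b_def)
  also have "\<dots> = b - c" using suminf_split_head[OF sum] by (simp add: b_def)
  finally have "x (c * b) = x (b - c)" by simp
  then show False using spectrumD(3,4)[OF x] c \<open>b \<in> A\<close> by simp
qed

lemma spectrum_tendsto:
  assumes x: "x \<in> spectrum A" and a: "a \<in> A" and p: "\<forall>\<^sub>F i in U. p i \<in> A" "(p \<longlongrightarrow> a) U"
  shows "((\<lambda>i. x (p i)) \<longlongrightarrow> x a) U"
proof -
  have "((\<lambda>i. x (p i) - x a) \<longlongrightarrow> 0) U"
  proof (rule tendsto_0_le[where K=1])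
    show "((\<lambda>i. p i - a) \<longlongrightarrow> 0) U" using p(2) by (simp add: LIM_zero)
    show "\<forall>\<^sub>F i in U. norm (x (p i) - x a) \<le> norm (p i - a) * 1"
      using p(1)
    proof (rule eventually_mono)
      fix i assume "p i \<in> A"
      then show "norm (x (p i) - x a) \<le> norm (p i - a) * 1"
        using spectrum_norm_le[OF x A_closed(4)[OF _ a]] spectrumD(4)[OF x _ a] by simp
    qed
  qed
  then show ?thesis by (rule LIM_zero_cancel)
qed

lemma spectrum_approximate_unit:
  assumes x: "x \<in> spectrum A" and u: "\<forall>\<^sub>F u in U. u \<in> A" "\<And>b. ((\<lambda>u. u * b) \<longlongrightarrow> b) U"
  shows "(x \<longlongrightarrow> 1) U"
proof -
  obtain a where a: "a \<in> A" "x a \<noteq> 0" using spectrumD(5)[OF x] by blast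
  have "((\<lambda>u. x (u * a)) \<longlongrightarrow> x a) U"
    by (rule spectrum_tendsto[OF x a(1) _ u(2)]) (use u(1) in \<open>auto elim!: eventually_mono intro: A_closed a\<close>)
  then have "((\<lambda>u. x (u * a) / x a) \<longlongrightarrow> x a / x a) U" by (intro tendsto_divide tendsto_const a)
  moreover have "\<forall>\<^sub>F u in U. x (u * a) / x a = x u"
    using u(1) by (rule eventually_mono) (simp add: spectrumD(3)[OF x] a)
  ultimately show ?thesis using a tendsto_cong by fastforce
qed

text \<open>Arens' trick: with \<open>u\<close> in place of the unit, \<open>\<parallel>s + i t u\<parallel>\<^sup>2 \<le> \<parallel>s\<parallel>\<^sup>2 + t\<^sup>2\<close>, while
  \<open>\<bar>x(s) + i t\<bar>\<^sup>2\<close> contains the term \<open>2 t Im x(s)\<close>, which is linear in the real number \<open>t\<close>.\<close>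

lemma spectrum_selfadjoint_real:
  assumes x: "x \<in> spectrum A" and s: "s \<in> A" "star s = s"
  shows "Im (x s) = 0"
proof -
  obtain U where U: "U \<noteq> bot" "\<forall>\<^sub>F u in U. u \<in> A \<and> star u = u \<and> norm u \<le> 1"
    "\<And>b. ((\<lambda>u. u * b) \<longlongrightarrow> b) U" by (rule approximate_unitE) blast
  have xu: "(x \<longlongrightarrow> 1) U"
    by (rule spectrum_approximate_unit[OF x _ U(3)]) (use U(2) in \<open>auto elim: eventually_mono\<close>)
  have le: "(cmod (x s + \<i> * complex_of_real t))\<^sup>2 \<le> (norm s)\<^sup>2 + t\<^sup>2" for t
  proof (rule tendsto_upperbound[OF _ _ U(1)])
    show "((\<lambda>u. (cmod (x s + \<i> * complex_of_real t * x u))\<^sup>2) \<longlongrightarrow> (cmod (x s + \<i> * complex_of_real t))\<^sup>2) U"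
      using xu by (auto intro!: tendsto_eq_intros)
    show "\<forall>\<^sub>F u in U. (cmod (x s + \<i> * complex_of_real t * x u))\<^sup>2 \<le> (norm s)\<^sup>2 + t\<^sup>2"
      using U(2)
    proof (rule eventually_mono)
      fix u assume u: "u \<in> A \<and> star u = u \<and> norm u \<le> 1"
      define w where "w = scaleC (\<i> * complex_of_real t) u"
      define a where "a = s + w"
      have aA: "a \<in> A" using s u A_closed by (simp add: a_def w_def)
      have "star w = - w" using u by (simp add: w_def star_scaleC)
      then have "star a * a = (s - w) * (s + w)" by (simp add: a_def star_add s)
      also have "\<dots> = s * s - w * w"
        using commute[of s w] s u A_closed by (simp add: w_def algebra_simps)
      also have "\<dots> = s * s + scaleR (t\<^sup>2) (u * u)"
      proof -
        have "\<i> * complex_of_real t * (\<i> * complex_of_real t) = - complex_of_real (t\<^sup>2)"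
          by (simp add: power2_eq_square complex_eq_iff)
        then show ?thesis
          by (simp add: w_def mult_scaleC_left mult_scaleC_right scaleC_scaleC scaleR_scaleC
              complex_vector.scale_minus_left)
      qed
      finally have "star a * a = s * s + scaleR (t\<^sup>2) (u * u)" .
      then have "(norm a)\<^sup>2 \<le> norm (s * s) + norm (scaleR (t\<^sup>2) (u * u))"
        using norm_triangle_ineq by (metis cstar_identity)
      also have "\<dots> \<le> (norm s)\<^sup>2 + t\<^sup>2"
      proof (rule add_mono)
        show "norm (s * s) \<le> (norm s)\<^sup>2" by (simp add: power2_eq_square norm_mult_ineq)
        have "norm (u * u) \<le> 1" using u norm_mult_ineq[of u u] mult_le_one[of "norm u" "norm u"] by simp
        then show "norm (scaleR (t\<^sup>2) (u * u)) \<le> t\<^sup>2" by (simp add: mult_left_le)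
      qed
      finally have na: "(norm a)\<^sup>2 \<le> (norm s)\<^sup>2 + t\<^sup>2" .
      have "x a = x s + \<i> * complex_of_real t * x u"
        using s u A_closed spectrumD(1,2)[OF x] by (simp add: a_def w_def)
      then have "(cmod (x s + \<i> * complex_of_real t * x u))\<^sup>2 \<le> (norm a)\<^sup>2"
        using spectrum_norm_le[OF x aA] by (intro power_mono) auto
      with na show "(cmod (x s + \<i> * complex_of_real t * x u))\<^sup>2 \<le> (norm s)\<^sup>2 + t\<^sup>2"
        by (rule order_trans[rotated])
    qed
  qed
  have lin: "2 * Im (x s) * t \<le> (norm s)\<^sup>2" for t
  proof -
    have "(cmod (x s + \<i> * complex_of_real t))\<^sup>2 = (Re (x s))\<^sup>2 + (Im (x s) + t)\<^sup>2"
      by (simp add: cmod_power2)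
    then have "(Im (x s) + t)\<^sup>2 \<le> (norm s)\<^sup>2 + t\<^sup>2" using le[of t] zero_le_power2[of "Re (x s)"] by linarith
    then have "(Im (x s))\<^sup>2 + 2 * Im (x s) * t \<le> (norm s)\<^sup>2" by (simp add: power2_sum)
    then show ?thesis using zero_le_power2[of "Im (x s)"] by linarith
  qed
  show ?thesis
  proof (rule ccontr)
    assume "Im (x s) \<noteq> 0"
    then show False using lin[of "((norm s)\<^sup>2 + 1) / (2 * Im (x s))"] by simp
  qed
qed

lemma spectrum_star:
  assumes x: "x \<in> spectrum A" and a: "a \<in> A"
  shows "x (star a) = cnj (x a)"
proof -
  have sa: "star a \<in> A" by (rule A_closed(2)[OF a])
  have mem: "a + star a \<in> A" "a - star a \<in> A" "scaleC \<i> (a - star a) \<in> A"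
    by (rule A_closed a sa)+
  have "Im (x (a + star a)) = 0"
    by (rule spectrum_selfadjoint_real[OF x mem(1)]) (simp add: star_add star_star add.commute)
  moreover have "Im (x (scaleC \<i> (a - star a))) = 0"
  proof (rule spectrum_selfadjoint_real[OF x])
    show "scaleC \<i> (a - star a) \<in> A" by (rule mem)
    have "star (scaleC \<i> (a - star a)) = scaleC (- \<i>) (- (a - star a))"
      by (simp add: star_scaleC star_diff star_star)
    then show "star (scaleC \<i> (a - star a)) = scaleC \<i> (a - star a)"
      by (simp only: complex_vector.scale_minus_left complex_vector.scale_minus_right minus_minus)
  qed
  ultimately show ?thesis
    by (simp add: spectrumD(1,2,4)[OF x] a sa mem complex_eq_iff)
qed

lemma point_ideal_subalgebra:
  assumes x: "x \<in> spectrum A" shows "commutative_star_subalgebra (point_ideal A x)"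
proof -
  have "0 \<in> A" using commutative_star_subalgebraD(5)[OF subalgebra] .
  moreover have "x 0 = 0" using spectrumD(4)[OF x \<open>0 \<in> A\<close> \<open>0 \<in> A\<close>] by simp
  ultimately show ?thesis
    using spectrumD[OF x] spectrum_star[OF x] A_closed commute
    by (auto simp: commutative_star_subalgebra_def point_ideal_def complex_vector.subspace_def)
qed

lemma normalizer_mult_mem:
  assumes n: "normalizer A n" shows "star n * n \<in> A"
proof -
  obtain U where U: "U \<noteq> bot" "\<forall>\<^sub>F u in U. u \<in> A \<and> star u = u \<and> norm u \<le> 1"
    "\<And>b. ((\<lambda>u. u * b) \<longlongrightarrow> b) U" by (rule approximate_unitE) blast
  show ?thesis
  proof (rule Lim_in_closed_set[OF closed_csubspaceD(1)[OF closed_csubspace_A] _ U(1)])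
    show "((\<lambda>u. star n * (u * n)) \<longlongrightarrow> star n * n) U" by (intro tendsto_intros U)
    show "\<forall>\<^sub>F u in U. star n * (u * n) \<in> A"
      using U(2) n by (auto elim!: eventually_mono simp: normalizer_def mult.assoc)
  qed
qed

lemma normalizer_mult_star_mem: "normalizer A n \<Longrightarrow> n * star n \<in> A"
  using normalizer_mult_mem[OF normalizer_star] by (simp add: star_star)

lemma normalizer_conj_mem:
  assumes "normalizer A n" "a \<in> A"
  shows "star n * a * n \<in> A" "n * a * star n \<in> A"
  using assms by (auto simp: normalizer_def)

lemma normalizer_action_eq:
  assumes "a \<in> A" "x (star n * n) \<noteq> 0"
  shows "x (star n * a * n) = x (star n * n) * normalizer_action A n x a"
  using assms by (simp add: normalizer_action_def)

text \<open>Both \<open>a\<close> and \<open>n n*\<close> belong to the commutative algebra \<open>A\<close>. This identity makes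
  \<open>a \<mapsto> x(n*an) / x(n*n)\<close> multiplicative.\<close>

lemma normalizer_conj_mult:
  assumes n: "normalizer A n" and a: "a \<in> A" and b: "b \<in> A"
  shows "(star n * a * n) * (star n * b * n) = (star n * n) * (star n * (a * b) * n)"
proof -
  have "(star n * a * n) * (star n * b * n) = star n * (a * (n * star n)) * (b * n)"
    by (simp add: mult.assoc)
  also have "\<dots> = star n * ((n * star n) * a) * (b * n)"
    using commute[OF a normalizer_mult_star_mem[OF n]] by simp
  finally show ?thesis by (simp add: mult.assoc)
qed

lemma normalizer_action_spectrum:
  assumes x: "x \<in> spectrum A" and n: "normalizer A n" and nz: "x (star n * n) \<noteq> 0"
  shows "normalizer_action A n x \<in> spectrum A"
proof -
  let ?y = "normalizer_action A n x"
  note xD = spectrumD[OF x] and mem = normalizer_conj_mem(1)[OF n] and nn = normalizer_mult_mem[OF n]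
  have "\<exists>a\<in>A. ?y a \<noteq> 0"
  proof (rule ccontr)
    assume "\<not> (\<exists>a\<in>A. ?y a \<noteq> 0)"
    then have zero: "x (star n * a * n) = 0" if "a \<in> A" for a
      using that nz by (auto simp: normalizer_action_def)
    obtain U where U: "U \<noteq> bot" "\<forall>\<^sub>F u in U. u \<in> A \<and> star u = u \<and> norm u \<le> 1"
      "\<And>b. ((\<lambda>u. u * b) \<longlongrightarrow> b) U" by (rule approximate_unitE) blast
    have "((\<lambda>u. x (star n * (u * n))) \<longlongrightarrow> x (star n * n)) U"
      using U(2) mem by (intro spectrum_tendsto[OF x nn] tendsto_intros U)
        (auto elim!: eventually_mono simp: mult.assoc)
    moreover have "\<forall>\<^sub>F u in U. x (star n * (u * n)) = 0"
      using U(2) zero by (auto elim!: eventually_mono simp: mult.assoc)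
    ultimately have "((\<lambda>u. 0) \<longlongrightarrow> x (star n * n)) U" using tendsto_cong by fastforce
    then show False using nz tendsto_unique[OF U(1) _ tendsto_const] by blast
  qed
  moreover have "?y (a * b) = ?y a * ?y b" if "a \<in> A" "b \<in> A" for a b
  proof -
    have "x (star n * a * n) * x (star n * b * n) = x (star n * n) * x (star n * (a * b) * n)"
      using arg_cong[OF normalizer_conj_mult[OF n that], of x] mem nn A_closed(1) that
      by (simp add: xD(3))
    then show ?thesis using that nz A_closed(1) by (simp add: normalizer_action_def field_simps)
  qed
  moreover have "?y (a + b) = ?y a + ?y b" if "a \<in> A" "b \<in> A" for a b
  proof -
    have "star n * (a + b) * n = star n * a * n + star n * b * n" by (simp add: algebra_simps)
    then show ?thesis using xD(1) mem that A_closed by (simp add: normalizer_action_def add_divide_distrib)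
  qed
  moreover have "?y (scaleC c a) = c * ?y a" if "a \<in> A" for a c
  proof -
    have "star n * scaleC c a * n = scaleC c (star n * a * n)"
      by (simp add: mult_scaleC_left mult_scaleC_right)
    then show ?thesis using xD(2) mem that A_closed by (simp add: normalizer_action_def)
  qed
  moreover have "?y \<in> extensional A" by (simp add: normalizer_action_def)
  ultimately show ?thesis by (simp add: spectrum_def)
qed

lemma normalizer_action_mult_star:
  assumes x: "x \<in> spectrum A" and n: "normalizer A n" and nz: "x (star n * n) \<noteq> 0"
  shows "normalizer_action A n x (n * star n) = x (star n * n)"
proof -
  have "star n * (n * star n) * n = (star n * n) * (star n * n)" by (simp add: mult.assoc)
  then show ?thesis
    using normalizer_mult_star_mem[OF n] normalizer_mult_mem[OF n] nz spectrumD(3)[OF x]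
    by (simp add: normalizer_action_def)
qed

lemma normalizer_action_star_inverse:
  assumes x: "x \<in> spectrum A" and n: "normalizer A n" and nz: "x (star n * n) \<noteq> 0"
  shows "normalizer_action A (star n) (normalizer_action A n x) = x"
proof
  fix a
  show "normalizer_action A (star n) (normalizer_action A n x) a = x a"
  proof (cases "a \<in> A")
    case True
    have "star n * (n * a * star n) * n = (star n * n) * a * (star n * n)" by (simp add: mult.assoc)
    then have "normalizer_action A n x (n * a * star n) = x (star n * n) * x a"
      using normalizer_conj_mem(2)[OF n True] normalizer_mult_mem[OF n] nz spectrumD(3)[OF x] True A_closed(1)
      by (simp add: normalizer_action_def)
    then show ?thesis
      using normalizer_action_mult_star[OF x n nz] True nz
      by (simp add: normalizer_action_def[of A "star n"] star_star)
  next
    case False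
    then show ?thesis using x by (simp add: normalizer_action_def spectrum_def extensional_def)
  qed
qed

lemma normalizer_mem_right_ideal:
  assumes x: "x \<in> spectrum A" and n: "normalizer A n" and z: "x (star n * n) = 0"
  shows "n \<in> sprod UNIV (point_ideal A x)"
  by (rule mem_sprod_right_of_star_mult[OF point_ideal_subalgebra[OF x]])
    (simp add: point_ideal_def z normalizer_mult_mem[OF n])

text \<open>Here \<open>(j n)*(j n) = n*(j*j)n\<close> is an element of \<open>A\<close> at which \<open>x\<close> vanishes, because the translated
  character vanishes at \<open>j*j\<close>.\<close>

lemma point_ideal_mult_normalizer:
  assumes x: "x \<in> spectrum A" and n: "normalizer A n" and nz: "x (star n * n) \<noteq> 0"
    and j: "j \<in> point_ideal A (normalizer_action A n x)"
  shows "j * n \<in> sprod UNIV (point_ideal A x)"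
proof (rule mem_sprod_right_of_star_mult[OF point_ideal_subalgebra[OF x]])
  have jA: "star j * j \<in> A" and "normalizer_action A n x (star j * j) = 0"
    using commutative_star_subalgebraD(2,3)[OF point_ideal_subalgebra[OF normalizer_action_spectrum[OF x n nz]]] j
    by (auto simp: point_ideal_def)
  then have "x (star n * (star j * j) * n) = 0" using normalizer_action_eq[of _ x n] nz by simp
  then show "star (j * n) * (j * n) \<in> point_ideal A x"
    using normalizer_conj_mem(1)[OF n jA] by (simp add: point_ideal_def star_mult mult.assoc)
qed

lemma normalizer_mult_point_ideal:
  assumes x: "x \<in> spectrum A" and n: "normalizer A n" and nz: "x (star n * n) \<noteq> 0"
    and j: "j \<in> point_ideal A x"
  shows "n * j \<in> sprod (point_ideal A (normalizer_action A n x)) UNIV"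
proof -
  let ?y = "normalizer_action A n x"
  note y = normalizer_action_spectrum[OF x n nz]
  have n': "normalizer A (star n)" using n by (rule normalizer_star)
  have nz': "?y (star (star n) * star n) \<noteq> 0"
    using normalizer_action_mult_star[OF x n nz] nz by (simp add: star_star)
  have "star j \<in> point_ideal A x" using commutative_star_subalgebraD(3)[OF point_ideal_subalgebra[OF x]] j .
  then have "star j * star n \<in> sprod UNIV (point_ideal A ?y)"
    using point_ideal_mult_normalizer[OF y n' nz'] normalizer_action_star_inverse[OF x n nz] by simp
  from star_mem_sprod_left[OF commutative_star_subalgebraD(3)[OF point_ideal_subalgebra[OF y]] this]
  show ?thesis by (simp add: star_mult star_star)
qed

lemma sprod_mult_normalizer:
  assumes x: "x \<in> spectrum A" and n: "normalizer A n" and nz: "x (star n * n) \<noteq> 0"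
    and b: "b \<in> sprod UNIV (point_ideal A (normalizer_action A n x))"
  shows "b * n \<in> sprod UNIV (point_ideal A x)"
proof -
  have "sprod UNIV (point_ideal A (normalizer_action A n x)) \<subseteq> (\<lambda>b. b * n) -` sprod UNIV (point_ideal A x)"
    by (rule sprod_minimal)
      (auto intro!: closed_csubspace_vimage_right sprod_UNIV_left_ideal
        point_ideal_mult_normalizer[OF x n nz] simp: mult.assoc)
  then show ?thesis using b by auto
qed

lemma separating_element:
  assumes x: "x \<in> spectrum A" and y: "y \<in> spectrum A" and ne: "x \<noteq> y"
  shows "\<exists>e\<in>A. x e = 0 \<and> y e = 1"
proof -
  obtain a where a: "a \<in> A" "x a \<noteq> y a"
    using ne extensionalityI[of x A y] x y unfolding spectrum_def by blast
  obtain b where b: "b \<in> A" "y b \<noteq> 0" using spectrumD(5)[OF y] by blast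
  define e where "e = scaleC (1 / ((y a - x a) * y b)) (a * b - scaleC (x a) b)"
  have mem: "a * b \<in> A" "scaleC (x a) b \<in> A" "a * b - scaleC (x a) b \<in> A" using a b A_closed by auto
  have "x e = 0" by (simp add: e_def spectrumD(2-4)[OF x] mem a b)
  moreover have "y (a * b - scaleC (x a) b) = (y a - x a) * y b"
    by (simp add: spectrumD(2-4)[OF y] mem a b left_diff_distrib)
  then have "y e = 1" using mem a b spectrumD(2)[OF y] by (simp add: e_def)
  moreover have "e \<in> A" using mem A_closed by (simp add: e_def)
  ultimately show ?thesis by blast
qed

text \<open>If \<open>x(n*n) = 0\<close> then \<open>n \<in> BJ\<^sub>x\<close>. If \<open>n\<close> moves \<open>x\<close> to \<open>y\<close> then \<open>n \<in> C\<^sub>y\<^sub>x\<close>. If \<open>n\<close> moves \<open>x\<close> to another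
  point, choose \<open>e \<in> A\<close> vanishing there with \<open>y(e) = 1\<close>; then \<open>n = (n - e n) + e n\<close> with the first
  term in \<open>J\<^sub>yB\<close> and the second in \<open>BJ\<^sub>x\<close>.\<close>

lemma normalizer_mem_C_plus_L:
  assumes x: "x \<in> spectrum A" and y: "y \<in> spectrum A" and n: "normalizer A n"
  shows "n \<in> C_space A y x \<or> n \<in> L_space A y x"
proof -
  let ?Jx = "point_ideal A x" and ?Jy = "point_ideal A y"
  have sup: "sprod ?Jy UNIV \<subseteq> L_space A y x" "sprod UNIV ?Jx \<subseteq> L_space A y x"
    unfolding L_space_def by (simp_all add: ssum_superset)
  show ?thesis
  proof (cases "x (star n * n) = 0")
    case True
    then show ?thesis using normalizer_mem_right_ideal[OF x n] sup by blast
  next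
    case nz: False
    let ?z = "normalizer_action A n x"
    note z = normalizer_action_spectrum[OF x n nz]
    show ?thesis
    proof (cases "?z = y")
      case True
      then have "n \<in> C_space A y x"
        using normalizer_mult_point_ideal[OF x n nz] point_ideal_mult_normalizer[OF x n nz]
        by (simp add: C_space_def)
      then show ?thesis ..
    next
      case False
      then obtain e where e: "e \<in> A" "?z e = 0" "y e = 1" using separating_element[OF z y] by blast
      have "e * n \<in> sprod UNIV ?Jx"
        using point_ideal_mult_normalizer[OF x n nz] e by (simp add: point_ideal_def)
      moreover have "n - e * n \<in> sprod ?Jy UNIV"
      proof -
        obtain U where U: "U \<noteq> bot" "\<forall>\<^sub>F u in U. u \<in> A \<and> star u = u \<and> norm u \<le> 1"
          "\<And>b. ((\<lambda>u. u * b) \<longlongrightarrow> b) U" by (rule approximate_unitE) blast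
        show ?thesis
        proof (rule Lim_in_closed_set[OF closed_csubspaceD(1)[OF closed_csubspace_sprod] _ U(1)])
          show "((\<lambda>u. (u * n) - e * (u * n)) \<longlongrightarrow> n - e * n) U"
            by (intro tendsto_diff tendsto_mult tendsto_const U(3))
          show "\<forall>\<^sub>F u in U. (u * n) - e * (u * n) \<in> sprod ?Jy UNIV"
            using U(2)
          proof (rule eventually_mono)
            fix u assume u: "u \<in> A \<and> star u = u \<and> norm u \<le> 1"
            then have "u - e * u \<in> ?Jy"
              by (simp add: point_ideal_def A_closed e spectrumD(3,4)[OF y])
            then have "(u - e * u) * n \<in> sprod ?Jy UNIV" by (simp add: mult_mem_sprod)
            then show "(u * n) - e * (u * n) \<in> sprod ?Jy UNIV"
              by (simp add: left_diff_distrib mult.assoc)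
          qed
        qed
      qed
      ultimately have "(n - e * n) + e * n \<in> L_space A y x"
        unfolding L_space_def by (rule add_mem_ssum[rotated])
      then show ?thesis by simp
    qed
  qed
qed

end

section \<open>Positive functionals and states\<close>

definition positive_functional :: "('a::cstar_algebra \<Rightarrow> complex) \<Rightarrow> bool" where
  "positive_functional f \<longleftrightarrow> bounded_linear f \<and> (\<forall>c b. f (scaleC c b) = c * f b) \<and>
     (\<forall>b. f (star b * b) \<in> \<real>\<^sub>\<ge>\<^sub>0)"

lemma state_iff_positive_functional: "state f \<longleftrightarrow> positive_functional f \<and> onorm f = 1"
  by (auto simp: state_def positive_functional_def)

lemma positive_functionalD:
  assumes "positive_functional f"
  shows "bounded_linear f" "f (scaleC c b) = c * f b" "f (a + b) = f a + f b"
    "f (a - b) = f a - f b" "Im (f (star b * b)) = 0" "0 \<le> Re (f (star b * b))"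
proof -
  show bl: "bounded_linear f" using assms by (simp add: positive_functional_def)
  show "f (a + b) = f a + f b" "f (a - b) = f a - f b"
    using linear_add linear_diff bounded_linear.linear[OF bl] by blast+
qed (use assms in \<open>auto simp: positive_functional_def complex_nonneg_Reals_iff\<close>)

lemma positive_functional_hermitian:
  assumes f: "positive_functional f"
  shows "f (star b * a) = cnj (f (star a * b))"
proof -
  note fD = positive_functionalD[OF f]
  have "star (a + b) * (a + b) = star a * a + star a * b + (star b * a + star b * b)"
    by (simp add: star_add distrib_left distrib_right)
  from arg_cong[OF this, of "\<lambda>z. Im (f z)"]
  have im: "Im (f (star a * b)) + Im (f (star b * a)) = 0"
    by (simp add: fD(3) fD(5))
  have "star (a + scaleC \<i> b) * (a + scaleC \<i> b)
      = star a * a + scaleC \<i> (star a * b) + (scaleC (- \<i>) (star b * a) + star b * b)"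
    by (simp add: star_add star_scaleC distrib_left distrib_right mult_scaleC_left
        mult_scaleC_right scaleC_scaleC scaleC_one left_diff_distrib scaleC_diff_right)
  from arg_cong[OF this, of "\<lambda>z. Im (f z)"]
  have re: "Re (f (star a * b)) - Re (f (star b * a)) = 0"
    by (simp add: fD(2,3,5) del: complex_vector.scale_minus_left)
  show ?thesis using im re by (simp add: complex_eq_iff)
qed

lemma positive_functional_Cauchy_Schwarz:
  assumes f: "positive_functional f"
  shows "(cmod (f (star a * b)))\<^sup>2 \<le> Re (f (star a * a)) * Re (f (star b * b))"
proof -
  note fD = positive_functionalD[OF f]
  define w where "w = f (star a * b)"
  define \<alpha> where "\<alpha> = Re (f (star a * a))"
  define \<beta> where "\<beta> = Re (f (star b * b))"
  define s where "s = (cmod w)\<^sup>2"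
  have nn: "0 \<le> \<alpha>" "0 \<le> \<beta>" "0 \<le> s" by (simp_all add: \<alpha>_def \<beta>_def s_def fD)
  have quad: "0 \<le> \<alpha> + 2 * t * s + t\<^sup>2 * s * \<beta>" for t :: real
  proof -
    \<comment> \<open>The phase of \<open>c\<close> makes \<open>c w\<close> real; the resulting real quadratic in \<open>t\<close> is nonnegative.\<close>
    define c where "c = complex_of_real t * cnj w"
    have "s = (Re w)\<^sup>2 + (Im w)\<^sup>2" by (simp add: s_def cmod_power2)
    then have cw: "Re (c * w) = t * s" "(cmod c)\<^sup>2 = t\<^sup>2 * s"
      by (simp add: c_def power2_eq_square algebra_simps)
        (simp add: c_def s_def norm_mult power_mult_distrib)
    have "star (a + scaleC c b) * (a + scaleC c b)
        = star a * a + scaleC c (star a * b) + (scaleC (cnj c) (star b * a) + scaleC (cnj c * c) (star b * b))"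
      by (simp add: star_add star_scaleC distrib_left distrib_right mult_scaleC_left
          mult_scaleC_right scaleC_scaleC scaleC_add_right mult.commute[of c])
    then have "f (star (a + scaleC c b) * (a + scaleC c b))
        = f (star a * a) + c * w + (cnj (c * w) + complex_of_real ((cmod c)\<^sup>2) * f (star b * b))"
      by (simp only: fD(2,3) w_def positive_functional_hermitian[OF f, of b a] complex_cnj_mult
          complex_norm_square mult.commute[of c "cnj c"])
    then have "Re (f (star (a + scaleC c b) * (a + scaleC c b))) = \<alpha> + 2 * Re (c * w) + (cmod c)\<^sup>2 * \<beta>"
      by (simp add: \<alpha>_def \<beta>_def)
    then show ?thesis using fD(6)[of "a + scaleC c b"] by (simp only: cw mult.assoc)
  qed
  have "s \<le> \<alpha> * \<beta>"
  proof (cases "\<beta> = 0")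
    case True
    have "s = 0"
    proof (rule ccontr)
      assume "s \<noteq> 0"
      then show False using quad[of "- (\<alpha> + 1) / (2 * s)"] True by (simp add: field_simps)
    qed
    then show ?thesis using True by simp
  next
    case False
    then have "0 \<le> \<alpha> - s / \<beta>" using quad[of "- 1 / \<beta>"] by (simp add: power2_eq_square)
    then show ?thesis using False nn by (simp add: field_simps)
  qed
  then show ?thesis by (simp add: s_def w_def \<alpha>_def \<beta>_def)
qed

text \<open>Let \<open>K\<close> be the norm of \<open>g\<close>. The Cauchy-Schwarz inequality along the approximate unit gives
  \<open>\<bar>g(b)\<bar>\<^sup>2 \<le> g(b*b) \<le> K \<parallel>b\<parallel>\<^sup>2\<close>, so \<open>K\<^sup>2 \<le> K\<close>, and \<open>K \<ge> 1\<close> because \<open>g(u)\<close> tends to \<open>1\<close>.\<close>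

lemma normalized_positive_functional_state:
  fixes g :: "'a::cstar_algebra \<Rightarrow> complex" and U :: "'a filter"
  assumes g: "positive_functional g" and U: "U \<noteq> bot" "\<forall>\<^sub>F u in U. star u = u \<and> norm u \<le> 1"
    and unit: "\<And>b. ((\<lambda>u. u * b) \<longlongrightarrow> b) U"
    and lim: "((\<lambda>u. g u) \<longlongrightarrow> 1) U" "((\<lambda>u. g (u * u)) \<longlongrightarrow> 1) U"
  shows "state g"
proof -
  note gD = positive_functionalD[OF g]
  note bl = gD(1)
  let ?K = "onorm g"
  have K0: "0 \<le> ?K" by (rule onorm_pos_le[OF bl])
  have "norm (1::complex) \<le> ?K"
  proof (rule tendsto_upperbound[OF tendsto_norm[OF lim(1)] _ U(1)])
    show "\<forall>\<^sub>F u in U. norm (g u) \<le> ?K"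
      using U(2)
    proof (rule eventually_mono)
      fix u :: 'a assume u: "star u = u \<and> norm u \<le> 1"
      have "norm (g u) \<le> ?K * norm u" by (rule onorm[OF bl])
      also have "\<dots> \<le> ?K" using u K0 by (simp add: mult_left_le)
      finally show "norm (g u) \<le> ?K" .
    qed
  qed
  then have K1: "1 \<le> ?K" by simp
  have "norm (g b) \<le> sqrt ?K * norm b" for b
  proof -
    have "(cmod (g b))\<^sup>2 \<le> 1 * Re (g (star b * b))"
    proof (rule tendsto_le[OF U(1)])
      show "((\<lambda>u. Re (g (u * u)) * Re (g (star b * b))) \<longlongrightarrow> 1 * Re (g (star b * b))) U"
        using tendsto_Re[OF lim(2)] by (intro tendsto_mult tendsto_const) simp
      show "((\<lambda>u. (cmod (g (u * b)))\<^sup>2) \<longlongrightarrow> (cmod (g b))\<^sup>2) U"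
        by (intro tendsto_power tendsto_norm bounded_linear.tendsto[OF bl] unit)
      show "\<forall>\<^sub>F u in U. (cmod (g (u * b)))\<^sup>2 \<le> Re (g (u * u)) * Re (g (star b * b))"
        using U(2)
      proof (rule eventually_mono)
        fix u :: 'a assume "star u = u \<and> norm u \<le> 1"
        then show "(cmod (g (u * b)))\<^sup>2 \<le> Re (g (u * u)) * Re (g (star b * b))"
          using positive_functional_Cauchy_Schwarz[OF g, of u b] by simp
      qed
    qed
    also have "\<dots> \<le> norm (g (star b * b))" using complex_Re_le_cmod by simp
    also have "\<dots> \<le> ?K * norm (star b * b)" by (rule onorm[OF bl])
    also have "\<dots> = (sqrt ?K * norm b)\<^sup>2" using K0 by (simp add: cstar_identity power_mult_distrib)
    finally show ?thesis by (rule power2_le_imp_le) (simp add: K0)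
  qed
  then have "?K \<le> sqrt ?K" using K0 by (intro onorm_bound) auto
  from power_mono[OF this K0, of 2] have "?K\<^sup>2 \<le> ?K" using K0 by simp
  then have "?K = 1" using K1 by (simp add: power2_eq_square)
  then show ?thesis using g by (simp add: state_iff_positive_functional)
qed

lemma positive_functional_conj:
  assumes f: "positive_functional f" and m: "0 < m"
  shows "positive_functional (\<lambda>b. f (star n * b * n) / complex_of_real m)"
proof -
  note fD = positive_functionalD[OF f]
  have "bounded_linear (\<lambda>b. f (star n * b * n) * (1 / complex_of_real m))"
    by (intro bounded_linear_mult_const bounded_linear_compose[OF fD(1)]
        bounded_linear_compose[OF bounded_linear_mult_left bounded_linear_mult_right])
  moreover have "f (star n * scaleC c b * n) / complex_of_real m = c * (f (star n * b * n) / complex_of_real m)" for c b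
    by (simp add: mult_scaleC_left mult_scaleC_right fD)
  moreover have "f (star n * (star b * b) * n) / complex_of_real m \<in> \<real>\<^sub>\<ge>\<^sub>0" for b
    using fD(5,6)[of "b * n"] m by (simp add: complex_nonneg_Reals_iff star_mult mult.assoc)
  ultimately show ?thesis by (simp add: positive_functional_def)
qed

section \<open>Invariance of the free points\<close>

context abelian_inclusion
begin

lemma state_vanishes_on_point_ideal:
  assumes x: "x \<in> spectrum A" and f: "state f" "\<forall>a\<in>A. f a = x a" and j: "j \<in> point_ideal A x"
  shows "f (b * j) = 0" "f (j * b) = 0"
proof -
  have pf: "positive_functional f" using f(1) by (simp add: state_iff_positive_functional)
  note JD = commutative_star_subalgebraD[OF point_ideal_subalgebra[OF x]]
  have zero: "f (star i * i) = 0" if "i \<in> point_ideal A x" for i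
    using JD(2)[OF JD(3)[OF that] that] f(2) by (simp add: point_ideal_def)
  show "f (b * j) = 0"
    using positive_functional_Cauchy_Schwarz[OF pf, of "star b" j] zero[OF j] by (simp add: star_star)
  show "f (j * b) = 0"
    using positive_functional_Cauchy_Schwarz[OF pf, of "star j" b] zero[OF JD(3)[OF j]] by (simp add: star_star)
qed

text \<open>With \<open>u\<close> in place of the unit, \<open>u a - x(a) u\<close> lies in \<open>J\<^sub>x\<close>, which the state annihilates on both
  sides by the Cauchy-Schwarz inequality.\<close>

lemma state_multiplicative:
  assumes x: "x \<in> spectrum A" and f: "state f" "\<forall>a\<in>A. f a = x a" and a: "a \<in> A"
  shows "f (b * a) = f b * x a" "f (a * b) = x a * f b"
proof -
  have pf: "positive_functional f" using f(1) by (simp add: state_iff_positive_functional)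
  note fD = positive_functionalD[OF pf]
  obtain U where U: "U \<noteq> bot" "\<forall>\<^sub>F u in U. u \<in> A \<and> star u = u \<and> norm u \<le> 1"
    "\<And>b. ((\<lambda>u. u * b) \<longlongrightarrow> b) U" "\<And>b. ((\<lambda>u. b * u) \<longlongrightarrow> b) U"
    by (rule approximate_unitE) blast
  have mem: "u * a - scaleC (x a) u \<in> point_ideal A x" if "u \<in> A" for u
    using that a by (simp add: point_ideal_def A_closed spectrumD(2-4)[OF x] mult.commute)
  have r: "f (b * (u * a)) = f (b * u) * x a" if "u \<in> A" for u
    using state_vanishes_on_point_ideal(1)[OF x f mem[OF that], of b]
    by (simp add: right_diff_distrib mult_scaleC_right fD(2,4))
  have l: "f (a * (u * b)) = x a * f (u * b)" if "u \<in> A" for u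
  proof -
    have "a * (u * b) = u * a * b" using commute[OF a that] by (simp flip: mult.assoc)
    then show ?thesis
      using state_vanishes_on_point_ideal(2)[OF x f mem[OF that], of b]
      by (simp add: left_diff_distrib mult_scaleC_left fD(2,4))
  qed
  show "f (b * a) = f b * x a"
  proof (rule tendsto_unique[OF U(1)])
    show "((\<lambda>u. f (b * (u * a))) \<longlongrightarrow> f (b * a)) U"
      by (intro bounded_linear.tendsto[OF fD(1)] tendsto_mult tendsto_const U(3))
    have "((\<lambda>u. f (b * u) * x a) \<longlongrightarrow> f b * x a) U"
      by (intro bounded_linear.tendsto[OF fD(1)] tendsto_mult[of _ _ _ "\<lambda>_. x a"] tendsto_const U(4))
    moreover have "\<forall>\<^sub>F u in U. f (b * u) * x a = f (b * (u * a))"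
      using U(2) by (rule eventually_mono) (simp add: r)
    ultimately show "((\<lambda>u. f (b * (u * a))) \<longlongrightarrow> f b * x a) U" by (rule Lim_transform_eventually)
  qed
  show "f (a * b) = x a * f b"
  proof (rule tendsto_unique[OF U(1)])
    show "((\<lambda>u. f (a * (u * b))) \<longlongrightarrow> f (a * b)) U"
      by (intro bounded_linear.tendsto[OF fD(1)] tendsto_mult tendsto_const U(3))
    have "((\<lambda>u. x a * f (u * b)) \<longlongrightarrow> x a * f b) U"
      by (intro bounded_linear.tendsto[OF fD(1)] tendsto_mult[of "\<lambda>_. x a"] tendsto_const U(3))
    moreover have "\<forall>\<^sub>F u in U. x a * f (u * b) = f (a * (u * b))"
      using U(2) by (rule eventually_mono) (simp add: l)
    ultimately show "((\<lambda>u. f (a * (u * b))) \<longlongrightarrow> x a * f b) U" by (rule Lim_transform_eventually)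
  qed
qed

lemma state_normalizer_action:
  assumes x: "x \<in> spectrum A" and n: "normalizer A n" and nz: "x (star n * n) \<noteq> 0"
    and f: "state f" "\<forall>a\<in>A. f a = x a"
  shows "state (\<lambda>b. f (star n * b * n) / x (star n * n))"
    and "\<forall>a\<in>A. f (star n * a * n) / x (star n * n) = normalizer_action A n x a"
proof -
  have pf: "positive_functional f" using f(1) by (simp add: state_iff_positive_functional)
  note fD = positive_functionalD[OF pf]
  have fn: "f (star n * n) = x (star n * n)" using f(2) normalizer_mult_mem[OF n] by simp
  define m where "m = Re (x (star n * n))"
  have m_eq: "x (star n * n) = complex_of_real m"
    using fD(5)[of n] fn by (simp add: m_def complex_eq_iff)
  have "0 \<le> m" using fD(6)[of n] fn by (simp add: m_def)
  moreover have "m \<noteq> 0" using nz m_eq by auto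
  ultimately have m: "0 < m" by simp
  obtain U where U: "U \<noteq> bot" "\<forall>\<^sub>F u in U. u \<in> A \<and> star u = u \<and> norm u \<le> 1"
    "\<And>b. ((\<lambda>u. u * b) \<longlongrightarrow> b) U" "\<And>b. ((\<lambda>u. b * u) \<longlongrightarrow> b) U"
    by (rule approximate_unitE) blast
  let ?g = "\<lambda>b. f (star n * b * n) / complex_of_real m"
  have one: "f (star n * n) / complex_of_real m = 1" using fn m_eq m by simp
  have "state ?g"
  proof (rule normalized_positive_functional_state[OF positive_functional_conj[OF pf m] U(1) _ U(3)])
    show "\<forall>\<^sub>F u in U. star u = u \<and> norm u \<le> 1" using U(2) by (rule eventually_mono) blast
    have "((\<lambda>u. f ((star n * u) * n) / complex_of_real m) \<longlongrightarrow> f (star n * n) / complex_of_real m) U"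
      by (intro tendsto_divide bounded_linear.tendsto[OF fD(1)] tendsto_mult tendsto_const U(4)) (use m in simp)
    then show "((\<lambda>u. f (star n * u * n) / complex_of_real m) \<longlongrightarrow> 1) U" by (simp add: one)
    have "((\<lambda>u. f ((star n * u) * (u * n)) / complex_of_real m) \<longlongrightarrow> f (star n * n) / complex_of_real m) U"
      by (intro tendsto_divide bounded_linear.tendsto[OF fD(1)] tendsto_mult[OF U(4) U(3)] tendsto_const) (use m in simp)
    then show "((\<lambda>u. f (star n * (u * u) * n) / complex_of_real m) \<longlongrightarrow> 1) U"
      by (simp add: one mult.assoc)
  qed
  then show "state (\<lambda>b. f (star n * b * n) / x (star n * n))" by (simp add: m_eq)
  show "\<forall>a\<in>A. f (star n * a * n) / x (star n * n) = normalizer_action A n x a"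
    using f(2) normalizer_conj_mem(1)[OF n] by (simp add: normalizer_action_def)
qed

lemma free_pointsD:
  assumes "x \<in> free_points A"
  shows "x \<in> spectrum A" "\<exists>f. state f \<and> (\<forall>a\<in>A. f a = x a)"
    "state f \<Longrightarrow> \<forall>a\<in>A. f a = x a \<Longrightarrow> state g \<Longrightarrow> \<forall>a\<in>A. g a = x a \<Longrightarrow> f = g"
  using assms by (auto simp: free_points_def)

text \<open>Existence of an extension is transported by \<open>n\<close>. For uniqueness, let \<open>g\<close> and \<open>h\<close> be states
  extending the translated character \<open>y\<close>. Transporting them back by \<open>n*\<close> gives states extending \<open>x\<close>,
  which coincide, so \<open>g(n c n*) = h(n c n*)\<close> for all \<open>c\<close>. For \<open>c = n* b n\<close> this reads
  \<open>y(n n*)\<^sup>2 g(b) = y(n n*)\<^sup>2 h(b)\<close>.\<close>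

lemma free_points_normalizer_action:
  assumes x: "x \<in> free_points A" and n: "normalizer A n" and nz: "x (star n * n) \<noteq> 0"
  shows "normalizer_action A n x \<in> free_points A"
proof -
  let ?y = "normalizer_action A n x"
  note xs = free_pointsD(1)[OF x]
  note y = normalizer_action_spectrum[OF xs n nz]
  have n': "normalizer A (star n)" using n by (rule normalizer_star)
  have ynn: "?y (n * star n) = x (star n * n)" by (rule normalizer_action_mult_star[OF xs n nz])
  then have nz': "?y (star (star n) * star n) \<noteq> 0" using nz by (simp add: star_star)
  obtain f where "state f" "\<forall>a\<in>A. f a = x a" using free_pointsD(2)[OF x] by blast
  from state_normalizer_action[OF xs n nz this]
  have ex: "\<exists>g. state g \<and> (\<forall>a\<in>A. g a = ?y a)" by blast
  have "g = h" if g: "state g" "\<forall>a\<in>A. g a = ?y a" and h: "state h" "\<forall>a\<in>A. h a = ?y a" for g h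
  proof
    fix b
    let ?p = "n * star n"
    have pA: "?p \<in> A" by (rule normalizer_mult_star_mem[OF n])
    have "(\<lambda>b. g (n * b * star n) / ?y ?p) = (\<lambda>b. h (n * b * star n) / ?y ?p)"
      using state_normalizer_action[OF y n' nz' g] state_normalizer_action[OF y n' nz' h]
        free_pointsD(3)[OF x] by (simp add: star_star normalizer_action_star_inverse[OF xs n nz])
    then have "g (n * c * star n) = h (n * c * star n)" for c
      using nz ynn by (auto dest: fun_cong)
    from this[of "star n * b * n"] have "g (?p * (b * ?p)) = h (?p * (b * ?p))"
      by (simp add: mult.assoc)
    then show "g b = h b"
      using nz ynn by (simp add: state_multiplicative[OF y g pA] state_multiplicative[OF y h pA])
  qed
  then show ?thesis using y ex by (auto simp: free_points_def)
qed

end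

section \<open>The ideal of the free points\<close>

locale regular_abelian_inclusion = abelian_inclusion +
  assumes dense: "closure (cspan {n. normalizer A n}) = UNIV"
begin

lemma closed_csubspace_eq_UNIV:
  assumes "closed_csubspace M" "\<And>n. normalizer A n \<Longrightarrow> n \<in> M"
  shows "M = UNIV"
  using closure_cspan_minimal[of M "{n. normalizer A n}"] assms dense by auto

lemma loc_proj_zero_iff:
  assumes x: "x \<in> spectrum A" and y: "y \<in> spectrum A"
  shows "loc_proj A y x b = coset (H_space A y x) 0 \<longleftrightarrow> b \<in> L_space A y x"
proof (rule loc_proj_eq_zero_iff[OF point_ideal_subalgebra[OF x] point_ideal_subalgebra[OF y]])
  fix b
  let ?M = "{c + l | c l. c \<in> C_space A y x \<and> l \<in> L_space A y x}"
  have "?M = UNIV"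
  proof (rule closed_csubspace_eq_UNIV)
    show "closed_csubspace ?M"
      by (rule closed_csubspace_C_plus_L[OF point_ideal_subalgebra[OF x] point_ideal_subalgebra[OF y]])
    fix n assume "normalizer A n"
    note normalizer_mem_C_plus_L[OF x y this]
    moreover have "0 \<in> C_space A y x" "0 \<in> L_space A y x"
      by (rule closed_csubspaceD(3) closed_csubspace_C_space closed_csubspace_L_space)+
    ultimately show "n \<in> ?M" by force
  qed
  then obtain c l where "c \<in> C_space A y x" "l \<in> L_space A y x" "b = c + l" by blast
  then show "\<exists>c\<in>C_space A y x. b - c \<in> L_space A y x" by (intro bexI[of _ c]) auto
qed

abbreviation free_kernel :: "'a set" where
  "free_kernel \<equiv> (\<Inter>x\<in>free_points A. sprod UNIV (point_ideal A x))"

text \<open>The two conditions already agree at each free point: \<open>b*b \<in> L\<^sub>x\<^sub>x\<close> if and only if \<open>b \<in> BJ\<^sub>x\<close>.\<close>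

lemma Gamma_set_eq: "Gamma_set A = free_kernel"
proof -
  have "loc_proj A x x (star b * b) = coset (H_space A x x) 0 \<longleftrightarrow> b \<in> sprod UNIV (point_ideal A x)"
    if "x \<in> free_points A" for x b
  proof -
    note x = free_pointsD(1)[OF that]
    have "star b * b \<in> L_space A x x" if "b \<in> sprod UNIV (point_ideal A x)"
      using sprod_UNIV_left_ideal[OF that]
        ssum_superset(2)[OF closed_csubspace_sprod[of "point_ideal A x" UNIV]
          closed_csubspace_sprod[of UNIV "point_ideal A x"]]
      unfolding L_space_def by blast
    moreover have "b \<in> sprod UNIV (point_ideal A x)" if "star b * b \<in> L_space A x x"
      using mem_sprod_of_star_mult_mem_ssum[OF point_ideal_subalgebra[OF x]] that
      by (simp add: L_space_def)
    ultimately show ?thesis using loc_proj_zero_iff[OF x x] by blast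
  qed
  then show ?thesis by (auto simp: Gamma_set_def)
qed

lemma closed_csubspace_free_kernel: "closed_csubspace free_kernel"
  by (intro closed_csubspace_INT closed_csubspace_sprod)

lemma free_kernel_left_ideal: "b \<in> free_kernel \<Longrightarrow> c * b \<in> free_kernel"
  by (auto intro: sprod_UNIV_left_ideal)

text \<open>By regularity it suffices to multiply by a normalizer \<open>n\<close>. At a free point \<open>x\<close>, either \<open>n\<close> already
  lies in \<open>BJ\<^sub>x\<close>, or \<open>n\<close> moves \<open>x\<close> to a free point \<open>y\<close> and \<open>BJ\<^sub>yn \<subseteq> BJ\<^sub>x\<close>.\<close>

lemma free_kernel_right_ideal:
  assumes b: "b \<in> free_kernel" shows "b * c \<in> free_kernel"
proof -
  have "(\<lambda>c. b * c) -` free_kernel = UNIV"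
  proof (rule closed_csubspace_eq_UNIV)
    show "closed_csubspace ((\<lambda>c. b * c) -` free_kernel)"
      by (rule closed_csubspace_vimage_left[OF closed_csubspace_free_kernel])
    fix n assume n: "normalizer A n"
    have "b * n \<in> sprod UNIV (point_ideal A x)" if x: "x \<in> free_points A" for x
    proof (cases "x (star n * n) = 0")
      case True
      then show ?thesis
        by (intro sprod_UNIV_left_ideal normalizer_mem_right_ideal free_pointsD(1)[OF x] n)
    next
      case False
      then have "b \<in> sprod UNIV (point_ideal A (normalizer_action A n x))"
        using free_points_normalizer_action[OF x n] b by blast
      then show ?thesis by (rule sprod_mult_normalizer[OF free_pointsD(1)[OF x] n False])
    qed
    then show "n \<in> (\<lambda>c. b * c) -` free_kernel" by simp
  qed
  then show ?thesis by blast
qed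

text \<open>Since \<open>b\<close> lies in a right ideal, so does \<open>bb*\<close>, and this is \<open>c*c\<close> for \<open>c = b*\<close>.\<close>

lemma star_mem_free_kernel:
  assumes b: "b \<in> free_kernel" shows "star b \<in> free_kernel"
proof
  fix x assume x: "x \<in> free_points A"
  note J = point_ideal_subalgebra[OF free_pointsD(1)[OF x]]
  have "star (star b) * star b \<in> sprod UNIV (point_ideal A x)"
    using free_kernel_right_ideal[OF b, of "star b"] x by (auto simp: star_star)
  then have "star (star b) * star b \<in> ssum (sprod (point_ideal A x) UNIV) (sprod UNIV (point_ideal A x))"
    by (rule subsetD[OF ssum_superset(2)[OF closed_csubspace_sprod closed_csubspace_sprod]])
  then show "star b \<in> sprod UNIV (point_ideal A x)"
    by (rule mem_sprod_of_star_mult_mem_ssum[OF J])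
qed

lemma free_kernel_eq_left: "free_kernel = (\<Inter>x\<in>free_points A. sprod (point_ideal A x) UNIV)"
proof
  note star_J = commutative_star_subalgebraD(3)[OF point_ideal_subalgebra[OF free_pointsD(1)]]
  show "free_kernel \<subseteq> (\<Inter>x\<in>free_points A. sprod (point_ideal A x) UNIV)"
  proof (rule subsetI, rule INT_I)
    fix b x assume b: "b \<in> free_kernel" and x: "x \<in> free_points A"
    then have "star b \<in> sprod UNIV (point_ideal A x)" using star_mem_free_kernel by blast
    from star_mem_sprod_left[OF star_J[OF x] this] show "b \<in> sprod (point_ideal A x) UNIV"
      by (simp add: star_star)
  qed
  show "(\<Inter>x\<in>free_points A. sprod (point_ideal A x) UNIV) \<subseteq> free_kernel"
  proof
    fix b assume b: "b \<in> (\<Inter>x\<in>free_points A. sprod (point_ideal A x) UNIV)"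
    have "star b \<in> free_kernel"
    proof
      fix x assume x: "x \<in> free_points A"
      with b have "b \<in> sprod (point_ideal A x) UNIV" by blast
      from star_mem_sprod_right[OF star_J[OF x] this]
      show "star b \<in> sprod UNIV (point_ideal A x)" .
    qed
    from star_mem_free_kernel[OF this] show "b \<in> free_kernel" by (simp add: star_star)
  qed
qed

lemma closed_ideal_free_kernel: "closed_ideal free_kernel"
  using closed_csubspace_free_kernel free_kernel_left_ideal free_kernel_right_ideal
  unfolding closed_ideal_def closed_csubspace_def by blast

text \<open>For the converse direction, \<open>nL\<^sub>y\<^sub>x \<subseteq> L\<^sub>x\<^sub>x\<close> when the adjoint of the normalizer \<open>n\<close> moves \<open>x\<close> to \<open>y\<close>.
  Together with regularity this gives \<open>Bb \<subseteq> L\<^sub>x\<^sub>x\<close>, hence \<open>b*b \<in> L\<^sub>x\<^sub>x\<close>.\<close>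

lemma free_kernel_iff_L_space:
  "b \<in> free_kernel \<longleftrightarrow> (\<forall>x\<in>free_points A. \<forall>y\<in>free_points A. b \<in> L_space A y x)"
proof (intro iffI ballI INT_I)
  note sup = ssum_superset[OF closed_csubspace_sprod closed_csubspace_sprod]
  fix x assume x: "x \<in> free_points A"
  note xs = free_pointsD(1)[OF x]
  let ?Jx = "point_ideal A x"
  note Jx = point_ideal_subalgebra[OF xs]
  {
    fix y assume "b \<in> free_kernel"
    then show "b \<in> L_space A y x" using sup(2) x unfolding L_space_def by blast
  next
    assume L: "\<forall>x\<in>free_points A. \<forall>y\<in>free_points A. b \<in> L_space A y x"
    have "(\<lambda>c. c * b) -` L_space A x x = UNIV"
    proof (rule closed_csubspace_eq_UNIV)
      show "closed_csubspace ((\<lambda>c. c * b) -` L_space A x x)"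
        by (intro closed_csubspace_vimage_right closed_csubspace_L_space)
      fix n assume "normalizer A n"
      then have n: "normalizer A (star n)" by (rule normalizer_star)
      have "n * b \<in> L_space A x x"
      proof (cases "x (star (star n) * star n) = 0")
        case True
        then have "star n \<in> sprod UNIV ?Jx" by (rule normalizer_mem_right_ideal[OF xs n])
        then have "n \<in> sprod ?Jx UNIV"
          using star_mem_sprod_left[OF commutative_star_subalgebraD(3)[OF Jx]] star_star by metis
        then show ?thesis
          using sprod_UNIV_right_ideal sup(1) unfolding L_space_def by blast
      next
        case False
        let ?y = "normalizer_action A (star n) x"
        note y = free_points_normalizer_action[OF x n False]
        have "L_space A ?y x \<subseteq> (\<lambda>b. n * b) -` L_space A x x"
          unfolding L_space_def[of A ?y x]
        proof (rule ssum_minimal)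
          show cl: "closed_csubspace ((\<lambda>b. n * b) -` L_space A x x)"
            by (intro closed_csubspace_vimage_left closed_csubspace_L_space)
          show "sprod UNIV ?Jx \<subseteq> (\<lambda>b. n * b) -` L_space A x x"
            using sprod_UNIV_left_ideal sup(2) unfolding L_space_def by blast
          show "sprod (point_ideal A ?y) UNIV \<subseteq> (\<lambda>b. n * b) -` L_space A x x"
          proof (rule sprod_minimal[OF cl])
            fix j c assume "j \<in> point_ideal A ?y"
            then have "star j \<in> point_ideal A ?y"
              by (rule commutative_star_subalgebraD(3)[OF point_ideal_subalgebra[OF free_pointsD(1)[OF y]]])
            then have "star j * star n \<in> sprod UNIV ?Jx"
              by (rule point_ideal_mult_normalizer[OF xs n False])
            from star_mem_sprod_left[OF commutative_star_subalgebraD(3)[OF Jx] this]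
            have "n * j \<in> sprod ?Jx UNIV" by (simp add: star_mult star_star)
            then have "n * j * c \<in> sprod ?Jx UNIV" by (rule sprod_UNIV_right_ideal)
            from subsetD[OF sup(1) this] show "j * c \<in> (\<lambda>b. n * b) -` L_space A x x"
              by (simp add: L_space_def mult.assoc)
          qed
        qed
        then show ?thesis using L x y by blast
      qed
      then show "n \<in> (\<lambda>c. c * b) -` L_space A x x" by simp
    qed
    then have "star b * b \<in> L_space A x x" by blast
    then show "b \<in> sprod UNIV ?Jx"
      using mem_sprod_of_star_mult_mem_ssum[OF Jx] by (simp add: L_space_def)
  }
qed

end

theorem proposition11p8:
  fixes A :: "'a::cstar_algebra set"
  assumes regular: "regular_inclusion A"
    and abelian: "\<forall>a\<in>A. \<forall>b\<in>A. a * b = b * a"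
  shows "(Gamma_set A = (\<Inter>x\<in>free_points A. sprod UNIV (point_ideal A x)) \<and>
          Gamma_set A = (\<Inter>x\<in>free_points A. sprod (point_ideal A x) UNIV)) \<and>
         closed_ideal (Gamma_set A) \<and>
         (\<forall>b. b \<in> Gamma_set A \<longleftrightarrow>
           (\<forall>x\<in>free_points A. \<forall>y\<in>free_points A.
              loc_proj A y x b = coset (H_space A y x) 0))"
proof -
  interpret regular_abelian_inclusion A
    using regular abelian by unfold_locales (auto simp: regular_inclusion_def)
  have "(b \<in> free_kernel) = (\<forall>x\<in>free_points A. \<forall>y\<in>free_points A.
      loc_proj A y x b = coset (H_space A y x) 0)" for b
    unfolding free_kernel_iff_L_space using loc_proj_zero_iff free_pointsD(1) by blast
  then show ?thesis
    using Gamma_set_eq free_kernel_eq_left closed_ideal_free_kernel by simp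
qed

end
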